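(* Let $P_1,P_2$ be non-commutative Poisson algebras over $K$ of the same class (both of Class 1 or both of Class 2), with degree maps $u_i:P_i\to\mathbb Z_{\ge0}\cup\{-\infty\}$ ($i=1,2$) whose induced filtrations are finite and discrete. Let $z_i\in P_i$ for $i=1,2$ and $\Theta=z_1\otimes z_2\in P_1\otimes P_2$. Then: 1. If $z_i\in Z(P_i)$ for $i=1,2$, then $\Theta\in Z(P_1\otimes P_2)$. 2. Assume exactly one of the $z_i$ belongs to $Z(P_i)$, $i=1,2$; without loss of generality, let $z_1\in Z(P_1)$ and $z_2\notin Z(P_2)$. In this case the possible forms of the four subalgebras related to $\Theta$ are as follows: - $F(\Theta)$: if $z_1\notin K$, then $F(\Theta)=P_1\otimes N(z_2)$; if $z_1\in K^\times$, then $F(\Theta)=P_1\otimes F(z_2)$; - $D(\Theta)$: if $z_1\notin K$, then $D(\Theta)=P_1\otimes C(z_2)$; if $z_1\in K^\times$, then $D(\Theta)=P_1\otimes D(z_2)$; - $N(\Theta)$: $N(\Theta)=P_1\otimes N(z_2)$; - $C(\Theta)$: $C(\Theta)=P_1\otimes C(z_2)$.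
   Context: $K$ is an algebraically closed field of characteristic zero, $K^\times=K\setminus\{0\}$; tensor products are over $K$; $K$ is identified with $K\cdot 1\subseteq P_i$. A non-commutative Poisson algebra over $K$ is a $K$-vector space $P$ with a bilinear product $\cdot$ making it a unital associative (not necessarily commutative) $K$-algebra and a bilinear bracket $\{\cdot,\cdot\}$ making it a Lie algebra, such that $\{x,yz\}=\{x,y\}z+y\{x,z\}$ for all $x,y,z\in P$. It is of Class 1 if $(P,\cdot)$ is commutative, and of Class 2 if $(P,\cdot)$ is non-commutative and $\{a,b\}=ab-ba$ for all $a,b$. $Z(P)$ is the set of elements central for both the product and the bracket; for Class 1 or 2, $Z(P)=\{z\mid \{z,w\}=0\ \forall w\in P\}$. Tensor product: if $P_1,P_2$ are both of Class 1, $P_1\otimes P_2$ carries the bracket $\{a_1\otimes a_2,b_1\otimes b_2\}=\{a_1,b_1\}\otimes a_2b_2+b_1a_1\otimes\{a_2,b_2\}$; if both are of Class 2, the bracket on $P_1\otimes P_2$ is the commutator. This makes $P_1\otimes P_2$ a non-commutative Poisson algebra of the same class. A degree map on $P$ is a map $u:P\to\mathbb Z\cup\{-\infty\}$ such that for all $z,w\in P$: $u(\{z,w\})\le u(zw)=u(z)+u(w)$; $u(z+w)\le\max\{u(z),u(w)\}$; $u(z)=-\infty$ iff $z=0$. Its induced filtration is $P_t=\{a\in P\mid u(a)\le t\}$, $t\in\mathbb Z$; it is finite if every $P_t$ is finite dimensional over $K$ and discrete if $P_t=\{0\}$ for all $t<0$. For an element $z$ of a non-commutative Poisson algebra $P$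 put $ad_z(w)=\{z,w\}$ and $Ev(z)=\{\lambda\in K\mid \exists x\in P\setminus\{0\},\ ad_z(x)=\lambda x\}$, $F(z)=\{x\in P\mid \dim_K K[ad_z](x)<\infty\}$, $N(z)=\{x\in P\mid \exists m,\ ad_z^m(x)=0\}$, $C(z)=\{x\in P\mid ad_z(x)=0\}$, $D(z)=\bigoplus_{\lambda\in Ev(z)}\{x\in P\mid ad_z(x)=\lambda x\}$. For $z_i$ these are formed in $P_i$; for $\Theta$ they are formed in $P_1\otimes P_2$.
   Formalization: The formulas for N(Θ) and C(Θ) are stated only for z_1 ≠ 0: if z_1 = 0 then Θ = 0 and C(Θ) = P_1⊗P_2, whereas P_1⊗C(z_2) is a proper subspace because z_2 is not in Z(P_2), so the formula for C(Θ) fails. *)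

theory Defs
  imports
    "HOL-Library.Poly_Mapping"
    "HOL-Library.Extended"
    "HOL-Computational_Algebra.Polynomial"
begin

section \<open>Non-commutative Poisson algebras\<close>

text \<open>The associative unital product is that of the type class \<^class>\<open>ring_1\<close>; in particular
  \<open>0 \<noteq> 1\<close>, so that \<open>c \<mapsto> c \<cdot> 1\<close> embeds the ground field.\<close>

locale nc_poisson_algebra = vector_space scale
  for scale :: "'k::field \<Rightarrow> 'p::ring_1 \<Rightarrow> 'p" +
  fixes bracket :: "'p \<Rightarrow> 'p \<Rightarrow> 'p"
  assumes scale_mult_left: "scale c x * y = scale c (x * y)"
    and scale_mult_right: "x * scale c y = scale c (x * y)"
    and bracket_add_left: "bracket (x + y) z = bracket x z + bracket y z"
    and bracket_add_right: "bracket x (y + z) = bracket x y + bracket x z"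
    and bracket_scale_left: "bracket (scale c x) y = scale c (bracket x y)"
    and bracket_scale_right: "bracket x (scale c y) = scale c (bracket x y)"
    and bracket_self: "bracket x x = 0"
    and jacobi: "bracket x (bracket y z) + bracket y (bracket z x) + bracket z (bracket x y) = 0"
    and leibniz: "bracket x (y * z) = bracket x y * z + y * bracket x z"

text \<open>In \<open>poisson_class1\<close> the bracket only serves to fix the algebra.\<close>

definition poisson_class1 :: "('p::ring_1 \<Rightarrow> 'p \<Rightarrow> 'p) \<Rightarrow> bool" where
  "poisson_class1 bracket \<longleftrightarrow> (\<forall>x y :: 'p. x * y = y * x)"

definition poisson_class2 :: "('p::ring_1 \<Rightarrow> 'p \<Rightarrow> 'p) \<Rightarrow> bool" where
  "poisson_class2 bracket \<longleftrightarrow>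
     \<not> (\<forall>x y :: 'p. x * y = y * x) \<and> (\<forall>x y. bracket x y = x * y - y * x)"

definition poisson_center :: "('p::ring_1 \<Rightarrow> 'p \<Rightarrow> 'p) \<Rightarrow> 'p set" where
  "poisson_center bracket = {z. \<forall>w. z * w = w * z \<and> bracket z w = 0}"

definition scalars :: "('k::field \<Rightarrow> 'p::ring_1 \<Rightarrow> 'p) \<Rightarrow> 'p set" where
  "scalars scale = range (\<lambda>c. scale c 1)"

definition nonzero_scalars :: "('k::field \<Rightarrow> 'p::ring_1 \<Rightarrow> 'p) \<Rightarrow> 'p set" where
  "nonzero_scalars scale = (\<lambda>c. scale c 1) ` (UNIV - {0})"


section \<open>Degree maps\<close>

text \<open>Values lie in \<open>\<int> \<union> {-\<infinity>}\<close>, with \<open>-\<infinity>\<close> being \<^const>\<open>Minf\<close>; the additional element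
  \<^const>\<open>Pinf\<close> of the library type is excluded.\<close>

definition degree_map :: "('p::ring_1 \<Rightarrow> 'p \<Rightarrow> 'p) \<Rightarrow> ('p \<Rightarrow> int extended) \<Rightarrow> bool" where
  "degree_map bracket u \<longleftrightarrow>
     (\<forall>z. u z \<noteq> Pinf) \<and>
     (\<forall>z w. u (bracket z w) \<le> u (z * w)) \<and>
     (\<forall>z w. u (z * w) = u z + u w) \<and>
     (\<forall>z w. u (z + w) \<le> max (u z) (u w)) \<and>
     (\<forall>z. u z = Minf \<longleftrightarrow> z = 0)"

definition filtration :: "('p \<Rightarrow> int extended) \<Rightarrow> int \<Rightarrow> 'p set" where
  "filtration u t = {a. u a \<le> Fin t}"

definition finite_dim_subspace ::
  "('k::field \<Rightarrow> 'v::ab_group_add \<Rightarrow> 'v) \<Rightarrow> 'v set \<Rightarrow> bool" where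
  "finite_dim_subspace scale V \<longleftrightarrow> (\<exists>B. finite B \<and> V = module.span scale B)"

definition finite_filtration ::
  "('k::field \<Rightarrow> 'p::ring_1 \<Rightarrow> 'p) \<Rightarrow> ('p \<Rightarrow> int extended) \<Rightarrow> bool" where
  "finite_filtration scale u \<longleftrightarrow> (\<forall>t. finite_dim_subspace scale (filtration u t))"

definition discrete_filtration :: "('p::ring_1 \<Rightarrow> int extended) \<Rightarrow> bool" where
  "discrete_filtration u \<longleftrightarrow> (\<forall>t<0. filtration u t = {0})"


section \<open>Subalgebras attached to an element\<close>

text \<open>\<open>bracket z\<close> is the operator \<open>ad\<^sub>z\<close>.\<close>

definition eigenspace ::
  "('k::field \<Rightarrow> 'p::ring_1 \<Rightarrow> 'p) \<Rightarrow> ('p \<Rightarrow> 'p \<Rightarrow> 'p) \<Rightarrow> 'p \<Rightarrow> 'k \<Rightarrow> 'p set" where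
  "eigenspace scale bracket z l = {x. bracket z x = scale l x}"

definition Ev ::
  "('k::field \<Rightarrow> 'p::ring_1 \<Rightarrow> 'p) \<Rightarrow> ('p \<Rightarrow> 'p \<Rightarrow> 'p) \<Rightarrow> 'p \<Rightarrow> 'k set" where
  "Ev scale bracket z = {l. \<exists>x. x \<noteq> 0 \<and> bracket z x = scale l x}"

text \<open>The orbit \<open>K[ad\<^sub>z](x) = {p(ad\<^sub>z)(x) | p \<in> K[t]}\<close>.\<close>

definition ad_orbit ::
  "('k::field \<Rightarrow> 'p::ring_1 \<Rightarrow> 'p) \<Rightarrow> ('p \<Rightarrow> 'p \<Rightarrow> 'p) \<Rightarrow> 'p \<Rightarrow> 'p \<Rightarrow> 'p set" where
  "ad_orbit scale bracket z x =
     range (\<lambda>p :: 'k poly. \<Sum>i\<le>degree p. scale (coeff p i) ((bracket z ^^ i) x))"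

definition ad_F ::
  "('k::field \<Rightarrow> 'p::ring_1 \<Rightarrow> 'p) \<Rightarrow> ('p \<Rightarrow> 'p \<Rightarrow> 'p) \<Rightarrow> 'p \<Rightarrow> 'p set" where
  "ad_F scale bracket z = {x. finite_dim_subspace scale (ad_orbit scale bracket z x)}"

definition ad_N :: "('p::ring_1 \<Rightarrow> 'p \<Rightarrow> 'p) \<Rightarrow> 'p \<Rightarrow> 'p set" where
  "ad_N bracket z = {x. \<exists>m. (bracket z ^^ m) x = 0}"

definition ad_C :: "('p::ring_1 \<Rightarrow> 'p \<Rightarrow> 'p) \<Rightarrow> 'p \<Rightarrow> 'p set" where
  "ad_C bracket z = {x. bracket z x = 0}"

text \<open>The internal sum of the eigenspaces; it is direct because eigenvectors for distinct
  eigenvalues are linearly independent.\<close>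

definition ad_D ::
  "('k::field \<Rightarrow> 'p::ring_1 \<Rightarrow> 'p) \<Rightarrow> ('p \<Rightarrow> 'p \<Rightarrow> 'p) \<Rightarrow> 'p \<Rightarrow> 'p set" where
  "ad_D scale bracket z =
     module.span scale (\<Union>l \<in> Ev scale bracket z. eigenspace scale bracket z l)"


section \<open>Tensor products\<close>

text \<open>The tensor product of two vector spaces is the free vector space on the pairs \<open>(a, b)\<close>
  modulo the bilinearity relations.  As the scalar multiplications are not part of the types, this
  quotient cannot be introduced as a type; instead a space \<open>'t\<close> with a map
  \<open>tensor :: 'a \<Rightarrow> 'b \<Rightarrow> 't\<close> is said to be a tensor product when the linear extension of
  \<open>tensor\<close> to the free vector space is onto and its kernel is the span of the bilinearity relations,
  i.e. when it identifies the quotient with \<open>'t\<close>.  The universal property is derived below.\<close>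

definition free_scale :: "'k::field \<Rightarrow> ('i \<Rightarrow>\<^sub>0 'k) \<Rightarrow> ('i \<Rightarrow>\<^sub>0 'k)" where
  "free_scale c x = Poly_Mapping.map ((*) c) x"

definition free_extension ::
  "('k::field \<Rightarrow> 'v::ab_group_add \<Rightarrow> 'v) \<Rightarrow> ('i \<Rightarrow> 'v) \<Rightarrow> ('i \<Rightarrow>\<^sub>0 'k) \<Rightarrow> 'v" where
  "free_extension scale f x = (\<Sum>i\<in>Poly_Mapping.keys x. scale (Poly_Mapping.lookup x i) (f i))"

definition bilinearity_relations ::
  "('k::field \<Rightarrow> 'a::ab_group_add \<Rightarrow> 'a) \<Rightarrow> ('k \<Rightarrow> 'b::ab_group_add \<Rightarrow> 'b)
     \<Rightarrow> (('a \<times> 'b) \<Rightarrow>\<^sub>0 'k) set" where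
  "bilinearity_relations s1 s2 =
     {Poly_Mapping.single (a + a', b) 1
        - Poly_Mapping.single (a, b) 1 - Poly_Mapping.single (a', b) 1 | a a' b. True} \<union>
     {Poly_Mapping.single (a, b + b') 1
        - Poly_Mapping.single (a, b) 1 - Poly_Mapping.single (a, b') 1 | a b b'. True} \<union>
     {Poly_Mapping.single (s1 c a, b) 1 - Poly_Mapping.single (a, b) c | c a b. True} \<union>
     {Poly_Mapping.single (a, s2 c b) 1 - Poly_Mapping.single (a, b) c | c a b. True}"

definition is_tensor_product ::
  "('k::field \<Rightarrow> 'a::ab_group_add \<Rightarrow> 'a) \<Rightarrow> ('k \<Rightarrow> 'b::ab_group_add \<Rightarrow> 'b)
     \<Rightarrow> ('k \<Rightarrow> 't::ab_group_add \<Rightarrow> 't) \<Rightarrow> ('a \<Rightarrow> 'b \<Rightarrow> 't) \<Rightarrow> bool" where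
  "is_tensor_product s1 s2 sT tensor \<longleftrightarrow>
     range (free_extension sT (\<lambda>(a, b). tensor a b)) = UNIV \<and>
     {x. free_extension sT (\<lambda>(a, b). tensor a b) x = 0} =
       module.span free_scale (bilinearity_relations s1 s2)"

text \<open>The tensor product of two Poisson algebras of the same class.  Being bilinear, the
  operations are determined by their values on pure tensors.\<close>

definition poisson_tensor_product ::
  "('k::field \<Rightarrow> 'a::ring_1 \<Rightarrow> 'a) \<Rightarrow> ('a \<Rightarrow> 'a \<Rightarrow> 'a)
     \<Rightarrow> ('k \<Rightarrow> 'b::ring_1 \<Rightarrow> 'b) \<Rightarrow> ('b \<Rightarrow> 'b \<Rightarrow> 'b)
     \<Rightarrow> ('k \<Rightarrow> 't::ring_1 \<Rightarrow> 't) \<Rightarrow> ('t \<Rightarrow> 't \<Rightarrow> 't) \<Rightarrow> ('a \<Rightarrow> 'b \<Rightarrow> 't) \<Rightarrow> bool" where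
  "poisson_tensor_product s1 br1 s2 br2 sT brT tensor \<longleftrightarrow>
     nc_poisson_algebra sT brT \<and>
     is_tensor_product s1 s2 sT tensor \<and>
     (\<forall>a b a' b'. tensor a b * tensor a' b' = tensor (a * a') (b * b')) \<and>
     (poisson_class1 br1 \<and> poisson_class1 br2 \<longrightarrow>
        (\<forall>a1 a2 b1 b2. brT (tensor a1 a2) (tensor b1 b2) =
           tensor (br1 a1 b1) (a2 * b2) + tensor (b1 * a1) (br2 a2 b2))) \<and>
     (poisson_class2 br1 \<and> poisson_class2 br2 \<longrightarrow>
        (\<forall>x y. brT x y = x * y - y * x))"

text \<open>For subspaces \<open>A\<close> and \<open>B\<close>, the subspace \<open>A \<otimes> B\<close> of the tensor product.\<close>

definition tensor_subspace ::
  "('k::field \<Rightarrow> 't::ab_group_add \<Rightarrow> 't) \<Rightarrow> ('a \<Rightarrow> 'b \<Rightarrow> 't) \<Rightarrow> 'a set \<Rightarrow> 'b set \<Rightarrow> 't set" where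
  "tensor_subspace sT tensor A B = module.span sT {tensor a b | a b. a \<in> A \<and> b \<in> B}"


subsection \<open>The universal property\<close>

lemma lookup_free_scale [simp]: "Poly_Mapping.lookup (free_scale c x) i = c * Poly_Mapping.lookup x i"
  by (simp add: free_scale_def Poly_Mapping.map.rep_eq when_def)

interpretation free: vector_space free_scale
  by unfold_locales (auto intro!: Poly_Mapping.poly_mapping_eqI simp: Poly_Mapping.lookup_add algebra_simps)

lemma free_extension_superset:
  assumes "vector_space s" "finite A" "Poly_Mapping.keys x \<subseteq> A"
  shows "free_extension s f x = (\<Sum>i\<in>A. s (Poly_Mapping.lookup x i) (f i))"
proof -
  interpret vector_space s by fact
  show ?thesis
    unfolding free_extension_def
    by (rule sum.mono_neutral_left) (use assms in \<open>auto simp: in_keys_iff\<close>)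
qed

lemma free_extension_single:
  assumes "vector_space s"
  shows "free_extension s f (Poly_Mapping.single i c) = s c (f i)"
proof -
  interpret vector_space s by fact
  show ?thesis
    by (subst free_extension_superset[OF assms, of "{i}"]) (auto split: if_splits)
qed

lemma linear_free_extension:
  assumes "vector_space s"
  shows "Vector_Spaces.linear free_scale s (free_extension s f)"
proof -
  interpret V: vector_space s by fact
  have add: "free_extension s f (x + y) = free_extension s f x + free_extension s f y" for x y
  proof -
    have *: "finite (Poly_Mapping.keys x \<union> Poly_Mapping.keys y)" by simp
    show ?thesis
      unfolding free_extension_superset[OF assms *, of x, simplified]
        free_extension_superset[OF assms *, of y, simplified]
        free_extension_superset[OF assms *, OF Poly_Mapping.keys_add]
      by (simp add: Poly_Mapping.lookup_add V.scale_left_distrib sum.distrib)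
  qed
  have scale: "free_extension s f (free_scale c x) = s c (free_extension s f x)" for c x
  proof -
    have "Poly_Mapping.keys (free_scale c x) \<subseteq> Poly_Mapping.keys x" by (auto simp: Poly_Mapping.in_keys_iff)
    then show ?thesis
      by (subst free_extension_superset[OF assms, of "Poly_Mapping.keys x"])
         (simp_all add: free_extension_def V.scale_sum_right)
  qed
  show ?thesis
    unfolding Vector_Spaces.linear_iff
    using add scale assms free.vector_space_axioms by blast
qed

text \<open>The linear extension of \<open>f\<close> vanishes on the relations iff \<open>f\<close> is bilinear.\<close>

lemma bilinear_iff_relations:
  assumes "vector_space s"
  shows "(\<forall>r \<in> bilinearity_relations s1 s2. free_extension s (\<lambda>(a, b). f a b) r = 0) \<longleftrightarrow>
     (\<forall>a a' b. f (a + a') b = f a b + f a' b) \<and> (\<forall>a b b'. f a (b + b') = f a b + f a b') \<and>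
     (\<forall>c a b. f (s1 c a) b = s c (f a b)) \<and> (\<forall>c a b. f a (s2 c b) = s c (f a b))"
proof -
  interpret V: vector_space s by fact
  interpret L: Vector_Spaces.linear free_scale s "free_extension s (\<lambda>(a, b). f a b)"
    by (rule linear_free_extension) fact
  have ball: "(\<forall>r\<in>{g x y z | x y z. True}. P r) \<longleftrightarrow> (\<forall>x y z. P (g x y z))"
    for g :: "'x \<Rightarrow> 'y \<Rightarrow> 'z \<Rightarrow> 'w" and P by blast
  show ?thesis
    unfolding bilinearity_relations_def ball_Un ball L.diff free_extension_single[OF assms]
      V.scale_one prod.case conj_assoc
    by (simp add: diff_diff_eq)
qed

theorem tensor_product_universal:
  assumes "vector_space s1" "vector_space s2" "vector_space sT" "vector_space sW"
    and T: "is_tensor_product s1 s2 sT tensor"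
    and f: "\<And>a a' b. f (a + a') b = f a b + f a' b" "\<And>a b b'. f a (b + b') = f a b + f a b'"
      "\<And>c a b. f (s1 c a) b = sW c (f a b)" "\<And>c a b. f a (s2 c b) = sW c (f a b)"
  shows "\<exists>!g. Vector_Spaces.linear sT sW g \<and> (\<forall>a b. g (tensor a b) = f a b)"
proof -
  interpret VT: vector_space sT by fact
  interpret VW: vector_space sW by fact
  define p where "p = free_extension sT (\<lambda>(a, b). tensor a b)"
  define q where "q = free_extension sW (\<lambda>(a, b). f a b)"
  interpret p: Vector_Spaces.linear free_scale sT p
    unfolding p_def by (rule linear_free_extension) fact
  interpret q: Vector_Spaces.linear free_scale sW q
    unfolding q_def by (rule linear_free_extension) fact
  have surj: "surj p" and ker: "p x = 0 \<longleftrightarrow> x \<in> free.span (bilinearity_relations s1 s2)" for x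
    using T unfolding is_tensor_product_def p_def by auto
  have "q r = 0" if "r \<in> bilinearity_relations s1 s2" for r
    using bilinear_iff_relations[OF \<open>vector_space sW\<close>, of s1 s2 f] f that
    unfolding q_def by blast
  then have q0: "q x = 0" if "p x = 0" for x
    using that q.eq_0_on_span unfolding ker by blast
  have qp: "q x = q y" if "p x = p y" for x y
    using q0[of "x - y"] that by (simp add: p.diff q.diff)
  define g where "g t = q (inv p t)" for t
  have gp: "g (p x) = q x" for x
    unfolding g_def by (rule qp) (simp add: surj f_inv_into_f)
  have single: "p (Poly_Mapping.single (a, b) 1) = tensor a b"
    "q (Poly_Mapping.single (a, b) 1) = f a b" for a b
    unfolding p_def q_def
    by (simp_all add: free_extension_single[OF \<open>vector_space sT\<close>]
        free_extension_single[OF \<open>vector_space sW\<close>])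
  show ?thesis
  proof (rule ex1I[of _ g], intro conjI allI)
    show "Vector_Spaces.linear sT sW g"
    proof (unfold Vector_Spaces.linear_iff, intro conjI allI)
      show "vector_space sT" "vector_space sW" by fact+
      show "g (x + y) = g x + g y" for x y
        using surj gp p.add q.add by (metis surjD)
      show "g (sT c x) = sW c (g x)" for c x
        using surj gp p.scale q.scale by (metis surjD)
    qed
    show "g (tensor a b) = f a b" for a b
      using gp[of "Poly_Mapping.single (a, b) 1"] by (simp add: single)
  next
    fix h assume h: "Vector_Spaces.linear sT sW h \<and> (\<forall>a b. h (tensor a b) = f a b)"
    interpret h: Vector_Spaces.linear sT sW h using h by simp
    have "h (p x) = q x" for x
      unfolding p_def q_def free_extension_def using h
      by (simp add: h.sum h.scale split_def)
    then show "h = g" using surj gp by (metis surjD ext)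
  qed
qed

text \<open>Exchanging the factors of a tensor product gives a tensor product, so statements about
  \<open>P\<^sub>1 \<otimes> P\<^sub>2\<close> may be made up to the order of the factors.\<close>

context
begin

private definition sw :: "(('a \<times> 'b) \<Rightarrow>\<^sub>0 'k::field) \<Rightarrow> (('b \<times> 'a) \<Rightarrow>\<^sub>0 'k)" where
  "sw = free_extension free_scale (\<lambda>(a, b). Poly_Mapping.single (b, a) 1)"

private lemma linear_sw: "Vector_Spaces.linear free_scale free_scale sw"
  unfolding sw_def by (rule linear_free_extension) (rule free.vector_space_axioms)

private lemma sw_single: "sw (Poly_Mapping.single (a, b) c) = Poly_Mapping.single (b, a) c"
  unfolding sw_def free_extension_single[OF free.vector_space_axioms]
  by (auto intro!: Poly_Mapping.poly_mapping_eqI simp: Poly_Mapping.lookup_single when_def)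

private lemma linear_eq_on_singles:
  fixes f g :: "('i \<Rightarrow>\<^sub>0 'k::field) \<Rightarrow> 'v::ab_group_add"
  assumes "Vector_Spaces.linear free_scale s f" "Vector_Spaces.linear free_scale s g"
    and "\<And>i c. f (Poly_Mapping.single i c) = g (Poly_Mapping.single i c)"
  shows "f x = g x"
proof -
  interpret f: Vector_Spaces.linear free_scale s f by fact
  interpret g: Vector_Spaces.linear free_scale s g by fact
  have "x = (\<Sum>i\<in>Poly_Mapping.keys x. Poly_Mapping.single i (Poly_Mapping.lookup x i))"
    by (rule Poly_Mapping.poly_mapping_eqI)
       (auto simp: Poly_Mapping.lookup_sum Poly_Mapping.lookup_single Poly_Mapping.in_keys_iff
         when_def sum.delta)
  then obtain S where "x = (\<Sum>i\<in>S. Poly_Mapping.single i (Poly_Mapping.lookup x i))" ..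
  then show ?thesis
    using assms(3) by (metis (no_types, lifting) f.sum g.sum sum.cong)
qed

private lemma sw_sw: "sw (sw x) = x"
proof -
  have "Vector_Spaces.linear free_scale free_scale (\<lambda>x. x :: ('a \<times> 'b) \<Rightarrow>\<^sub>0 'c)"
    using free.linear_id unfolding id_def .
  moreover have "Vector_Spaces.linear free_scale free_scale (sw \<circ> sw)"
    using linear_sw linear_sw by (rule Vector_Spaces.linear_compose)
  ultimately show ?thesis
    using linear_eq_on_singles[of free_scale "sw \<circ> sw" "\<lambda>x. x" x] by (auto simp: sw_single)
qed

lemma is_tensor_product_swap:
  assumes "vector_space sT" and T: "is_tensor_product s1 s2 sT tensor"
  shows "is_tensor_product s2 s1 sT (\<lambda>b a. tensor a b)"
proof -
  define p where "p = free_extension sT (\<lambda>(a, b). tensor a b)"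
  define p' where "p' = free_extension sT (\<lambda>(b, a). tensor a b)"
  have lp: "Vector_Spaces.linear free_scale sT p" and lp': "Vector_Spaces.linear free_scale sT p'"
    unfolding p_def p'_def by (rule linear_free_extension, fact)+
  interpret p: Vector_Spaces.linear free_scale sT p by fact
  interpret p': Vector_Spaces.linear free_scale sT p' by fact
  interpret sw: Vector_Spaces.linear free_scale free_scale sw by (rule linear_sw)
  have surj: "surj p" and ker: "p x = 0 \<longleftrightarrow> x \<in> free.span (bilinearity_relations s1 s2)" for x
    using T unfolding is_tensor_product_def p_def by auto
  have "Vector_Spaces.linear free_scale sT (p \<circ> sw)"
    using linear_sw lp by (rule Vector_Spaces.linear_compose)
  then have p_sw: "p (sw x) = p' x" for x
    using linear_eq_on_singles[OF _ lp', of "p \<circ> sw" x]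
    by (auto simp: sw_single p_def p'_def free_extension_single[OF \<open>vector_space sT\<close>])
  have "sw r \<in> bilinearity_relations s2 s1" if "r \<in> bilinearity_relations s1 s2" for r
    using that unfolding bilinearity_relations_def Un_iff
    by (elim disjE CollectE exE conjE; simp only: sw.diff sw_single; blast)
  then have "sw ` bilinearity_relations s1 s2 \<subseteq> bilinearity_relations s2 s1"
    by (rule image_subsetI)
  then have sp: "sw ` free.span (bilinearity_relations s1 s2)
      \<subseteq> free.span (bilinearity_relations s2 s1)"
    unfolding sw.span_image[symmetric] by (rule free.span_mono)
  have "sw x \<in> free.span (bilinearity_relations s2 s1)" if "p x = 0" for x
    using sp that unfolding ker by (rule subsetD[OF _ imageI])
  then have 1: "x \<in> free.span (bilinearity_relations s2 s1)" if "p' x = 0" for x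
    using that p_sw sw_sw by metis
  have "\<forall>r\<in>bilinearity_relations s1 s2. p r = 0"
    using ker free.span_base by blast
  then have "\<forall>r\<in>bilinearity_relations s2 s1. p' r = 0"
    unfolding p_def p'_def bilinear_iff_relations[OF \<open>vector_space sT\<close>] by blast
  then have 2: "p' x = 0" if "x \<in> free.span (bilinearity_relations s2 s1)" for x
    using that p'.eq_0_on_span by blast
  have "surj p'"
    using surj p_sw sw_sw unfolding surj_def by metis
  with 1 2 show ?thesis
    unfolding is_tensor_product_def p'_def by blast
qed

end

lemma poisson_tensor_product_swap:
  assumes "(poisson_class1 br1 \<and> poisson_class1 br2) \<or> (poisson_class2 br1 \<and> poisson_class2 br2)"
    and T: "poisson_tensor_product s1 br1 s2 br2 sT brT tensor"
  shows "poisson_tensor_product s2 br2 s1 br1 sT brT (\<lambda>b a. tensor a b)"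
proof -
  from T have "vector_space sT" and tp: "is_tensor_product s1 s2 sT tensor"
    unfolding poisson_tensor_product_def nc_poisson_algebra_def by auto
  then have "is_tensor_product s2 s1 sT (\<lambda>b a. tensor a b)"
    by (rule is_tensor_product_swap)
  moreover have "tensor (a1 * b1) (br2 a2 b2) + tensor (br1 a1 b1) (b2 * a2) =
      tensor (br1 a1 b1) (a2 * b2) + tensor (b1 * a1) (br2 a2 b2)"
    if "poisson_class1 br1" "poisson_class1 br2" for a1 a2 b1 b2
    using that unfolding poisson_class1_def by (metis add.commute)
  ultimately show ?thesis
    using T unfolding poisson_tensor_product_def by auto
qed

end

theory Submission
  imports Defs
begin

text \<open>Since \<open>z\<^sub>1\<close> is central, \<open>ad\<^sub>\<Theta> = L \<otimes> A\<close>, where \<open>L\<close> is multiplication by \<open>z\<^sub>1\<close> on \<open>P\<^sub>1\<close> and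
  \<open>A = ad\<close> of \<open>z\<^sub>2\<close> on \<open>P\<^sub>2\<close>.  A tensor \<open>t\<close> is studied through its slices \<open>(\<phi> \<otimes> id) t \<in> P\<^sub>2\<close>, for
  linear functionals \<open>\<phi>\<close> on \<open>P\<^sub>1\<close>: \<open>t \<in> P\<^sub>1 \<otimes> B\<close> as soon as all slices lie in \<open>B\<close>, and the
  \<open>\<phi>\<close>-slice of \<open>ad\<^sub>\<Theta>\<^sup>n t\<close> is \<open>A\<^sup>n\<close> applied to the \<open>(\<phi> \<circ> L\<^sup>n)\<close>-slice of \<open>t\<close>.  The degree map makes
  \<open>P\<^sub>1\<close> a domain, so \<open>L\<close> is injective and every functional factors through \<open>L\<^sup>n\<close>; this gives
  \<open>C(\<Theta>)\<close> and \<open>N(\<Theta>)\<close>.  If \<open>z\<^sub>1 \<notin> K\<close>, then \<open>z\<^sub>1\<close> has positive degree: otherwise its powers lie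
  in a finite-dimensional space, \<open>L\<close> has an eigenvector, and \<open>z\<^sub>1\<close> is a scalar.  Hence the ranges
  of \<open>L\<^sup>n\<close> meet only in \<open>0\<close>, and, slicing along \<open>P\<^sub>2\<close>, so do those of \<open>ad\<^sub>\<Theta>\<^sup>n\<close>.  This excludes
  nonzero eigenvalues and forces \<open>F(\<Theta>) = N(\<Theta>)\<close>.\<close>

section \<open>Orbits of a linear operator\<close>

locale endomorphism = vector_space scale
  for scale :: "'a::field \<Rightarrow> 'b::ab_group_add \<Rightarrow> 'b" (infixr "*s" 75) +
  fixes f :: "'b \<Rightarrow> 'b"
  assumes linear: "Vector_Spaces.linear scale scale f"
begin

lemma linear_funpow: "Vector_Spaces.linear scale scale (f ^^ n)"
proof (induction n)
  case 0
  show ?case using linear_id by (simp add: id_def)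
next
  case (Suc n)
  then show ?case
    using Vector_Spaces.linear_compose[OF Suc linear] by (simp add: o_def)
qed

text \<open>One interpretation serves all powers at once; the instance \<open>1\<close> supplies the
  facts about \<open>f\<close> itself.\<close>

sublocale pow: Vector_Spaces.linear scale scale "f ^^ i" for i
  by (rule linear_funpow)

text \<open>This is \<open>p(f) x\<close>, written with the same sum as in \<open>ad_orbit\<close>,
  so that an orbit is the range of \<open>op_poly\<close> in its polynomial.\<close>

definition op_poly :: "'a poly \<Rightarrow> 'b \<Rightarrow> 'b" where
  "op_poly p x = (\<Sum>i\<le>degree p. coeff p i *s (f ^^ i) x)"

lemma op_poly_superset:
  fixes p :: "'a poly"
  assumes "degree p \<le> n"
  shows "op_poly p x = (\<Sum>i\<le>n. coeff p i *s (f ^^ i) x)"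
  unfolding op_poly_def
  by (rule sum.mono_neutral_left) (use assms in \<open>auto simp: coeff_eq_0\<close>)

lemma op_poly_add: "op_poly (p + q) x = op_poly p x + op_poly q x"
proof -
  let ?n = "max (degree p) (degree q)"
  have "degree (p + q) \<le> ?n" by (rule degree_add_le_max)
  then show ?thesis
    by (simp add: op_poly_superset[of _ ?n] scale_left_distrib sum.distrib)
qed

lemma op_poly_smult: "op_poly (smult c p) x = c *s op_poly p x"
  by (simp add: op_poly_superset[of "smult c p" "degree p"] op_poly_def[of p] scale_sum_right)

lemma op_poly_0: "op_poly 0 x = 0"
  by (simp add: op_poly_def)

lemma op_poly_monom: "op_poly (monom c i) x = c *s (f ^^ i) x"
proof -
  have "op_poly (monom c i) x = (\<Sum>j\<le>i. coeff (monom c i) j *s (f ^^ j) x)"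
    by (rule op_poly_superset) (rule degree_monom_le)
  also have "\<dots> = (\<Sum>j\<in>{i}. coeff (monom c i) j *s (f ^^ j) x)"
    by (rule sum.mono_neutral_right) auto
  finally show ?thesis by simp
qed

lemma op_poly_sum: "op_poly (\<Sum>i\<in>I. p i) x = (\<Sum>i\<in>I. op_poly (p i) x)"
  by (induction I rule: infinite_finite_induct) (simp_all add: op_poly_add op_poly_0)

lemma op_poly_pCons_0: "op_poly (pCons 0 q) x = f (op_poly q x)"
proof -
  have "op_poly (pCons 0 q) x = (\<Sum>i\<le>Suc (degree q). coeff (pCons 0 q) i *s (f ^^ i) x)"
    by (rule op_poly_superset) (rule degree_pCons_le)
  also have "\<dots> = (\<Sum>i\<le>degree q. coeff q i *s f ((f ^^ i) x))"
    by (subst sum.atMost_Suc_shift) simp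
  also have "\<dots> = f (op_poly q x)"
    using pow.sum[of 1 "\<lambda>i. coeff q i *s (f ^^ i) x" "{..degree q}"] pow.scale[of 1]
    by (simp add: op_poly_def)
  finally show ?thesis .
qed

text \<open>If this vector vanishes, then \<open>op_poly q x\<close> is zero or an eigenvector for
  \<open>l\<close>; roots of an annihilating polynomial lead to eigenvectors in this way.\<close>

lemma op_poly_linear_factor: "op_poly ([:- l, 1:] * q) x = f (op_poly q x) - l *s op_poly q x"
proof -
  have "[:- l, 1:] * q = smult (- l) q + pCons 0 q"
    by (simp add: mult_pCons_left)
  then show ?thesis
    by (simp only: op_poly_add op_poly_smult op_poly_pCons_0 scale_minus_left) simp
qed

text \<open>Turns finite dimensionality of the orbit into a condition on the iterates of
  \<open>x\<close> alone.\<close>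

lemma range_op_poly: "range (\<lambda>p. op_poly p x) = span (range (\<lambda>i. (f ^^ i) x))"
proof (rule equalityI)
  show "range (\<lambda>p. op_poly p x) \<subseteq> span (range (\<lambda>i. (f ^^ i) x))"
    unfolding op_poly_def by (intro image_subsetI span_sum span_scale span_base rangeI)
next
  have "subspace (range (\<lambda>p. op_poly p x))"
  proof (rule subspaceI)
    show "0 \<in> range (\<lambda>p. op_poly p x)"
      using op_poly_0 by (metis rangeI)
    show "v + w \<in> range (\<lambda>p. op_poly p x)"
      if "v \<in> range (\<lambda>p. op_poly p x)" "w \<in> range (\<lambda>p. op_poly p x)" for v w
      using that op_poly_add by (smt (verit) image_iff rangeI)
    show "c *s v \<in> range (\<lambda>p. op_poly p x)" if "v \<in> range (\<lambda>p. op_poly p x)" for c v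
      using that op_poly_smult by (smt (verit) image_iff rangeI)
  qed
  moreover have "range (\<lambda>i. (f ^^ i) x) \<subseteq> range (\<lambda>p. op_poly p x)"
  proof
    fix v assume "v \<in> range (\<lambda>i. (f ^^ i) x)"
    then obtain i where "v = op_poly (monom 1 i) x"
      by (auto simp: op_poly_monom)
    then show "v \<in> range (\<lambda>p. op_poly p x)" by simp
  qed
  ultimately show "span (range (\<lambda>i. (f ^^ i) x)) \<subseteq> range (\<lambda>p. op_poly p x)"
    by (rule span_minimal[rotated])
qed

section \<open>Locally finite and locally nilpotent vectors\<close>

definition locally_finite :: "'b \<Rightarrow> bool" where
  "locally_finite x \<longleftrightarrow> (\<exists>B. finite B \<and> (\<forall>i. (f ^^ i) x \<in> span B))"

text \<open>A maximal independent subset of \<open>V\<close> is finite because it lies in the span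
  of the finite set \<open>B\<close>, and it spans exactly \<open>V\<close>.\<close>

lemma finite_dim_subspace_iff:
  assumes "subspace V"
  shows "finite_dim_subspace scale V \<longleftrightarrow> (\<exists>B. finite B \<and> V \<subseteq> span B)"
proof
  assume "\<exists>B. finite B \<and> V \<subseteq> span B"
  then obtain B where B: "finite B" "V \<subseteq> span B" by blast
  obtain C where C: "C \<subseteq> V" "independent C" "V \<subseteq> span C"
    by (rule maximal_independent_subset)
  have "finite C"
    using independent_span_bound[OF B(1) C(2)] B(2) C(1) by blast
  moreover have "V = span C"
    using C span_minimal[OF C(1) assms] by blast
  ultimately show "finite_dim_subspace scale V"
    unfolding finite_dim_subspace_def by blast
qed (auto simp: finite_dim_subspace_def)

lemma finite_dim_orbit_iff:
  "finite_dim_subspace scale (range (\<lambda>p. op_poly p x)) \<longleftrightarrow> locally_finite x"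
proof -
  have "span (range (\<lambda>i. (f ^^ i) x)) \<subseteq> span B \<longleftrightarrow> (\<forall>i. (f ^^ i) x \<in> span B)" for B
  proof
    show "span (range (\<lambda>i. (f ^^ i) x)) \<subseteq> span B" if "\<forall>i. (f ^^ i) x \<in> span B"
      by (rule span_minimal) (use that in auto)
  qed (auto intro: span_base)
  then show ?thesis
    unfolding range_op_poly finite_dim_subspace_iff[OF subspace_span] locally_finite_def by simp
qed

text \<open>Infinitely many iterates in a finite-dimensional space satisfy a linear relation, whose
  coefficients form the polynomial.\<close>

lemma locally_finite_imp_annihilated:
  assumes "locally_finite x"
  obtains p where "p \<noteq> 0" "op_poly p x = 0"
proof -
  obtain B where B: "finite B" "\<And>i. (f ^^ i) x \<in> span B"
    using assms unfolding locally_finite_def by blast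
  let ?g = "\<lambda>i. (f ^^ i) x"
  show thesis
  proof (cases "inj ?g")
    \<comment> \<open>Linear dependence is a property of the set of iterates and does not see
      repetitions, so two equal iterates get their own polynomial, a difference of
      monomials.\<close>
    case False
    then obtain i j where ij: "i \<noteq> j" "?g i = ?g j" unfolding inj_def by blast
    let ?p = "monom (1 :: 'a) i + smult (- 1) (monom 1 j)"
    have "coeff ?p i \<noteq> 0" using ij by simp
    then have "?p \<noteq> 0" by (metis coeff_0)
    moreover have "op_poly ?p x = 0"
      unfolding op_poly_add op_poly_smult op_poly_monom using ij by simp
    ultimately show thesis by (rule that)
  next
    case True
    then have "infinite (range ?g)" by (simp add: finite_image_iff)
    then have "dependent (range ?g)"
      using independent_span_bound[OF B(1)] B(2) by blast
    then obtain t u v where t: "finite t" "t \<subseteq> range ?g" "(\<Sum>v\<in>t. u v *s v) = 0" "v \<in> t" "u v \<noteq> 0"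
      unfolding dependent_explicit by blast
    then obtain I where I: "finite I" "t = ?g ` I"
      by (meson finite_subset_image)
    obtain k where k: "k \<in> I" "v = ?g k" using I t by blast
    let ?p = "\<Sum>i\<in>I. monom (u (?g i)) i"
    have "coeff ?p k = (\<Sum>i\<in>I. if i = k then u (?g i) else 0)"
      by (simp add: coeff_sum)
    also have "\<dots> \<noteq> 0" using I k t by simp
    finally have "?p \<noteq> 0" by (metis coeff_0)
    moreover have "inj_on ?g I" using True by (rule inj_on_subset) simp
    then have "(\<Sum>i\<in>I. u (?g i) *s ?g i) = 0"
      using t(3) unfolding I(2) by (simp add: sum.reindex)
    then have "op_poly ?p x = 0"
      by (simp add: op_poly_sum op_poly_monom)
    ultimately show thesis by (rule that)
  qed
qed

lemma subspace_locally_finite: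
  shows "subspace {x. locally_finite x}"
proof (rule subspaceI)
  show "0 \<in> {x. locally_finite x}"
    by (auto simp: locally_finite_def pow.zero span_zero)
  show "c *s x \<in> {x. locally_finite x}" if "x \<in> {x. locally_finite x}" for c x
    using that by (auto simp: locally_finite_def pow.scale intro!: span_scale)
  show "x + y \<in> {x. locally_finite x}"
    if "x \<in> {x. locally_finite x}" and "y \<in> {x. locally_finite x}" for x y
  proof -
    obtain B C where BC: "finite B" "\<And>i. (f ^^ i) x \<in> span B" "finite C" "\<And>i. (f ^^ i) y \<in> span C"
      using \<open>x \<in> _\<close> \<open>y \<in> _\<close> unfolding locally_finite_def by blast
    have "(f ^^ i) (x + y) \<in> span (B \<union> C)" for i
      unfolding pow.add using BC span_mono[of B "B \<union> C"] span_mono[of C "B \<union> C"]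
      by (auto intro!: span_add)
    then show ?thesis using BC unfolding locally_finite_def by blast
  qed
qed

text \<open>For sums, \<open>f ^^ (m + n)\<close> factors through either power and kills both
  summands.\<close>

lemma subspace_locally_nilpotent:
  shows "subspace {x. \<exists>m. (f ^^ m) x = 0}"
proof (rule subspaceI)
  show "0 \<in> {x. \<exists>m. (f ^^ m) x = 0}"
    by (auto simp: pow.zero)
  show "c *s x \<in> {x. \<exists>m. (f ^^ m) x = 0}" if "x \<in> {x. \<exists>m. (f ^^ m) x = 0}" for c x
    using that by (auto simp: pow.scale)
  show "x + y \<in> {x. \<exists>m. (f ^^ m) x = 0}"
    if "x \<in> {x. \<exists>m. (f ^^ m) x = 0}" and "y \<in> {x. \<exists>m. (f ^^ m) x = 0}" for x y
  proof -
    obtain m n where mn: "(f ^^ m) x = 0" "(f ^^ n) y = 0"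
      using \<open>x \<in> _\<close> \<open>y \<in> _\<close> by blast
    have "(f ^^ (m + n)) x = (f ^^ n) ((f ^^ m) x)" "(f ^^ (m + n)) y = (f ^^ m) ((f ^^ n) y)"
      by (metis add.commute comp_apply funpow_add)+
    then have "(f ^^ (m + n)) (x + y) = 0"
      using mn by (simp add: pow.add pow.zero)
    then show ?thesis by blast
  qed
qed

lemma locally_nilpotent_imp_locally_finite:
  assumes "(f ^^ m) x = 0"
  shows "locally_finite x"
  unfolding locally_finite_def
proof (intro exI conjI allI)
  show "finite ((\<lambda>i. (f ^^ i) x) ` {..<m})" by simp
  show "(f ^^ i) x \<in> span ((\<lambda>i. (f ^^ i) x) ` {..<m})" for i
  proof (cases "i < m")
    case False
    then have "(f ^^ i) x = (f ^^ (i - m)) ((f ^^ m) x)"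
      by (metis add.commute comp_apply funpow_add le_add_diff_inverse not_less)
    then show ?thesis using assms by (simp add: pow.zero span_zero)
  qed (auto intro: span_base)
qed

text \<open>Bootstrapping on \<open>m\<close>: once \<open>y\<close> is in the range of
  \<open>f ^^ m\<close>, each \<open>(f ^^ Suc j) y\<close> is in the range of
  \<open>f ^^ Suc m\<close>, and so is their combination \<open>y\<close>. The set \<open>J\<close>
  will be \<open>UNIV\<close> for locally finite vectors and \<open>{0}\<close> for
  eigenvectors.\<close>

lemma in_range_funpow:
  assumes y: "y \<in> span ((\<lambda>j. (f ^^ Suc j) y) ` J)"
  shows "y \<in> range (f ^^ m)"
proof (induction m)
  case (Suc m)
  have "(f ^^ Suc j) y \<in> range (f ^^ Suc m)" for j
  proof -
    obtain w where "y = (f ^^ m) w" using Suc by blast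
    then have "(f ^^ Suc j) y = (f ^^ (Suc j + m)) w" by (simp add: funpow_add)
    also have "\<dots> = (f ^^ Suc m) ((f ^^ j) w)"
      by (metis add.commute add_Suc_right comp_apply funpow_add)
    finally show ?thesis by simp
  qed
  moreover have "subspace (range (f ^^ Suc m))"
    by (rule pow.subspace_image) (rule subspace_UNIV)
  ultimately show ?case
    using y span_minimal[of "(\<lambda>j. (f ^^ Suc j) y) ` J" "range (f ^^ Suc m)"] by blast
qed simp

text \<open>If \<open>c\<^sub>r\<close> is the lowest nonzero coefficient of an annihilating polynomial of \<open>x\<close>, then
  \<open>f\<^sup>r x\<close> is a combination of its own images under \<open>f, f\<^sup>2, \<dots>\<close> and hence lies in the range of
  every power of \<open>f\<close>.\<close>

lemma locally_finite_imp_locally_nilpotent: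
  assumes ranges: "\<And>y. (\<And>m. y \<in> range (f ^^ m)) \<Longrightarrow> y = 0"
    and x: "locally_finite x"
  shows "\<exists>m. (f ^^ m) x = 0"
proof -
  obtain p where p: "p \<noteq> 0" "op_poly p x = 0"
    using locally_finite_imp_annihilated[OF x] .
  define r where "r = (LEAST i. coeff p i \<noteq> 0)"
  have r: "coeff p r \<noteq> 0"
    unfolding r_def by (rule LeastI[of _ "degree p"]) (use p in auto)
  have below: "coeff p i = 0" if "i < r" for i
    using that not_less_Least unfolding r_def by blast
  have le: "r \<le> degree p" using r by (rule le_degree)
  let ?y = "(f ^^ r) x"
  let ?S = "\<Sum>i\<in>{Suc r..degree p}. coeff p i *s (f ^^ i) x"
  have "op_poly p x = (\<Sum>i\<in>{r..degree p}. coeff p i *s (f ^^ i) x)"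
    unfolding op_poly_def by (rule sum.mono_neutral_right) (auto simp: below)
  also have "\<dots> = coeff p r *s ?y + ?S"
    using le by (rule sum.atLeast_Suc_atMost)
  finally have "coeff p r *s ?y = - ?S"
    using p(2) by (simp add: eq_neg_iff_add_eq_0)
  then have "?y = (1 / coeff p r) *s (- ?S)"
    using r by (metis divide_self_if scale_one scale_scale times_divide_eq_left mult_1)
  moreover have "(f ^^ i) x \<in> span ((\<lambda>j. (f ^^ Suc j) ?y) ` UNIV)" if "i \<in> {Suc r..degree p}" for i
  proof -
    have "i = Suc (i - Suc r) + r" using that by simp
    then have "(f ^^ i) x = (f ^^ Suc (i - Suc r)) ?y"
      by (metis comp_apply funpow_add)
    then show ?thesis by (auto intro!: span_base)
  qed
  ultimately have "?y \<in> span ((\<lambda>j. (f ^^ Suc j) ?y) ` UNIV)"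
    by (auto intro!: span_neg span_scale span_sum)
  then have "?y = 0"
    using in_range_funpow ranges by blast
  then show ?thesis by blast
qed

text \<open>Dividing by \<open>l\<close> makes \<open>y\<close> a multiple of its own image, the
  simplest case of \<open>in_range_funpow\<close>.\<close>

lemma eigenvector_in_range_funpow:
  assumes "f y = l *s y" "l \<noteq> 0"
  shows "y \<in> range (f ^^ m)"
proof (rule in_range_funpow[where J = "{0}"])
  have "y = (1 / l) *s (f ^^ Suc 0) y" using assms by simp
  also have "\<dots> \<in> span ((\<lambda>j. (f ^^ Suc j) y) ` {0})"
    by (intro span_scale span_base) simp
  finally show "y \<in> span ((\<lambda>j. (f ^^ Suc j) y) ` {0})" .
qed

end

text \<open>The map \<open>h\<close> sends the finite set \<open>B\<close> to a finite set whose
  span contains all iterates of \<open>y\<close>. The factors \<open>c i\<close> leave room for the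
  powers of a scalar \<open>z1\<close>.\<close>

lemma locally_finite_transfer:
  assumes "endomorphism s f" "endomorphism s' g" "Vector_Spaces.linear s s' h"
    and "endomorphism.locally_finite s f x"
    and "\<And>i. (g ^^ i) y = s' (c i) (h ((f ^^ i) x))"
  shows "endomorphism.locally_finite s' g y"
proof -
  interpret f: endomorphism s f by fact
  interpret g: endomorphism s' g by fact
  interpret h: Vector_Spaces.linear s s' h by fact
  obtain B where B: "finite B" "\<And>i. (f ^^ i) x \<in> f.span B"
    using assms(4) unfolding f.locally_finite_def by blast
  have "(g ^^ i) y \<in> g.span (h ` B)" for i
    unfolding assms(5) by (rule g.span_scale) (simp add: h.span_image B(2))
  then show ?thesis
    unfolding g.locally_finite_def using B(1) by blast
qed

text \<open>Linear factors are stripped from an annihilating polynomial, by induction on its degree: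
  either the cofactor \<open>q\<close> still annihilates \<open>x\<close>, or
  \<open>op_poly q x\<close> is an eigenvector for the root.\<close>

lemma locally_finite_imp_eigenvector:
  fixes s :: "'k::alg_closed_field \<Rightarrow> 'v::ab_group_add \<Rightarrow> 'v"
  assumes "endomorphism s f" "endomorphism.locally_finite s f x" "x \<noteq> 0"
  obtains l y where "y \<noteq> 0" "f y = s l y"
proof -
  interpret endomorphism s f by fact
  obtain p where "p \<noteq> 0" "op_poly p x = 0"
    using locally_finite_imp_annihilated[OF assms(2)] .
  then have "\<exists>l y. y \<noteq> 0 \<and> f y = s l y"
  proof (induction "degree p" arbitrary: p rule: less_induct)
    case less
    have "degree p > 0"
    proof (rule ccontr)
      assume "\<not> degree p > 0"
      then obtain c where "p = [:c:]" by (metis degree_eq_zeroE gr0I)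
      then show False using less.prems assms(3) by (simp add: op_poly_def)
    qed
    then obtain l where "poly p l = 0"
      using alg_closed_imp_poly_has_root by blast
    then obtain q where q: "p = [:- l, 1:] * q"
      unfolding poly_eq_0_iff_dvd by (elim dvdE)
    have "q \<noteq> 0" using less.prems q by auto
    show ?case
    proof (cases "op_poly q x = 0")
      case True
      have "degree p = Suc (degree q)"
        unfolding q using \<open>q \<noteq> 0\<close> by (subst degree_mult_eq) auto
      then show ?thesis using less.hyps[of q] \<open>q \<noteq> 0\<close> True by simp
    next
      case False
      moreover have "f (op_poly q x) = s l (op_poly q x)"
        using less.prems(2) unfolding q op_poly_linear_factor by simp
      ultimately show ?thesis by blast
    qed
  qed
  then show thesis using that by blast
qed

section \<open>Slices of tensors\<close>

lemma vector_space_mult: "vector_space ((*) :: 'k::field \<Rightarrow> 'k \<Rightarrow> 'k)"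
  by unfold_locales (simp_all add: algebra_simps)

locale tensor_product = V1: vector_space s1 + V2: vector_space s2 + VT: vector_space sT
  for s1 :: "'k::field \<Rightarrow> 'a::ab_group_add \<Rightarrow> 'a"
    and s2 :: "'k \<Rightarrow> 'b::ab_group_add \<Rightarrow> 'b"
    and sT :: "'k \<Rightarrow> 't::ab_group_add \<Rightarrow> 't" +
  fixes tensor :: "'a \<Rightarrow> 'b \<Rightarrow> 't"
  assumes is_tensor_product: "is_tensor_product s1 s2 sT tensor"
begin

lemma swap: "tensor_product s2 s1 sT (\<lambda>b a. tensor a b)"
  using is_tensor_product_swap[OF VT.vector_space_axioms is_tensor_product]
  by unfold_locales

lemma
  shows tensor_add_left: "tensor (a + a') b = tensor a b + tensor a' b"
    and tensor_add_right: "tensor a (b + b') = tensor a b + tensor a b'"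
    and tensor_scale_left: "tensor (s1 c a) b = sT c (tensor a b)"
    and tensor_scale_right: "tensor a (s2 c b) = sT c (tensor a b)"
proof -
  have "\<forall>r \<in> bilinearity_relations s1 s2. free_extension sT (\<lambda>(a, b). tensor a b) r = 0"
    using is_tensor_product free.span_base unfolding is_tensor_product_def by blast
  then show "tensor (a + a') b = tensor a b + tensor a' b"
    "tensor a (b + b') = tensor a b + tensor a b'"
    "tensor (s1 c a) b = sT c (tensor a b)"
    "tensor a (s2 c b) = sT c (tensor a b)"
    unfolding bilinear_iff_relations[OF VT.vector_space_axioms] by blast+
qed

lemma linear_tensor_left: "Vector_Spaces.linear s1 sT (\<lambda>a. tensor a b)"
  and linear_tensor_right: "Vector_Spaces.linear s2 sT (tensor a)"
  unfolding Vector_Spaces.linear_iff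
  by (simp_all add: V1.vector_space_axioms V2.vector_space_axioms VT.vector_space_axioms
      tensor_add_left tensor_add_right tensor_scale_left tensor_scale_right)

lemma tensor_0_right [simp]: "tensor a 0 = 0"
proof -
  interpret Vector_Spaces.linear s2 sT "tensor a" by (rule linear_tensor_right)
  show ?thesis by (rule zero)
qed

lemma tensor_0_left [simp]: "tensor 0 b = 0"
proof -
  interpret Vector_Spaces.linear s1 sT "\<lambda>a. tensor a b" by (rule linear_tensor_left)
  show ?thesis by (rule zero)
qed

lemma tensor_sum_left: "tensor (\<Sum>i\<in>I. a i) b = (\<Sum>i\<in>I. tensor (a i) b)"
proof -
  interpret Vector_Spaces.linear s1 sT "\<lambda>a. tensor a b" by (rule linear_tensor_left)
  show ?thesis by (rule sum)
qed

section \<open>Linear maps out of a tensor product, and slices\<close>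

lemma span_tensors: "VT.span {tensor a b | a b. True} = UNIV"
proof -
  have "t \<in> VT.span {tensor a b | a b. True}" for t
  proof -
    have "t \<in> range (free_extension sT (\<lambda>(a, b). tensor a b))"
      using is_tensor_product unfolding is_tensor_product_def by simp
    then obtain x where "t = free_extension sT (\<lambda>(a, b). tensor a b) x" by blast
    then show ?thesis
      unfolding free_extension_def
      by (auto intro!: VT.span_sum VT.span_scale intro: VT.span_base)
  qed
  then show ?thesis by blast
qed

lemma linear_eqI:
  assumes "Vector_Spaces.linear sT sW g" "Vector_Spaces.linear sT sW h"
    and "\<And>a b. g (tensor a b) = h (tensor a b)"
  shows "g t = h t"
proof -
  interpret vector_space_pair sT sW
    using assms(1) unfolding Vector_Spaces.linear_def vector_space_pair_def by blast
  show ?thesis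
    by (rule linear_eq_on[OF assms(1,2), of _ "{tensor a b | a b. True}"])
      (use assms(3) span_tensors in auto)
qed

text \<open>This is \<open>\<phi> \<otimes> id\<close> followed by the identification of K \<otimes>
  V with V, for the second factor V. For linear \<open>\<phi>\<close> the universal property gives
  existence and uniqueness.\<close>

definition slice :: "('a \<Rightarrow> 'k) \<Rightarrow> 't \<Rightarrow> 'b" where
  "slice \<phi> = (THE g. Vector_Spaces.linear sT s2 g \<and> (\<forall>a b. g (tensor a b) = s2 (\<phi> a) b))"

lemma
  assumes "Vector_Spaces.linear s1 (*) \<phi>"
  shows linear_slice: "Vector_Spaces.linear sT s2 (slice \<phi>)"
    and slice_tensor: "slice \<phi> (tensor a b) = s2 (\<phi> a) b"
proof -
  interpret \<phi>: Vector_Spaces.linear s1 "(*)" \<phi> by fact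
  have "\<exists>!g. Vector_Spaces.linear sT s2 g \<and> (\<forall>a b. g (tensor a b) = s2 (\<phi> a) b)"
    by (rule tensor_product_universal[OF V1.vector_space_axioms V2.vector_space_axioms
          VT.vector_space_axioms V2.vector_space_axioms is_tensor_product])
      (simp_all add: \<phi>.add \<phi>.scale V2.scale_left_distrib V2.scale_right_distrib mult.commute)
  from theI'[OF this]
  show "Vector_Spaces.linear sT s2 (slice \<phi>)" "slice \<phi> (tensor a b) = s2 (\<phi> a) b"
    unfolding slice_def by blast+
qed

text \<open>Expansion along a basis \<open>E\<close> of the first factor: \<open>t = \<Sum>\<^sub>e e \<otimes> e\<^sup>*(t)\<close>.\<close>

lemma in_tensor_subspace:
  assumes slices: "\<And>\<phi>. Vector_Spaces.linear s1 (*) \<phi> \<Longrightarrow> slice \<phi> t \<in> B"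
  shows "t \<in> tensor_subspace sT tensor UNIV B"
proof -
  define E where "E = V1.extend_basis {}"
  have E: "V1.independent E" "V1.span E = UNIV"
    unfolding E_def by (simp_all add: V1.independent_extend_basis V1.independent_empty)
  define \<phi> where "\<phi> e a = V1.representation E a e" for e a
  have \<phi>: "Vector_Spaces.linear s1 (*) (\<phi> e)" for e
    unfolding Vector_Spaces.linear_iff \<phi>_def
    by (simp add: V1.vector_space_axioms vector_space_mult
        V1.representation_add V1.representation_scale E)
  interpret slice: Vector_Spaces.linear sT s2 "slice (\<phi> e)" for e
    using \<phi> by (rule linear_slice)
  \<comment> \<open>Asking for the expansion over every finite index set containing \<open>S\<close>
    lets the induction merge the supports of two summands.\<close>
  have "\<exists>S. finite S \<and> (\<forall>S'. finite S' \<longrightarrow> S \<subseteq> S' \<longrightarrow> t = (\<Sum>e\<in>S'. tensor e (slice (\<phi> e) t)))"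
  proof -
    have "t \<in> VT.span {tensor a b | a b. True}" unfolding span_tensors ..
    then show ?thesis
    proof (induction rule: VT.span_induct_alt)
      case base
      show ?case by (auto simp: slice.zero)
    next
      case (step c x y)
      then obtain a b S where x: "x = tensor a b" and S: "finite S"
        "\<And>S'. finite S' \<Longrightarrow> S \<subseteq> S' \<Longrightarrow> y = (\<Sum>e\<in>S'. tensor e (slice (\<phi> e) y))"
        by blast
      let ?R = "{e. V1.representation E a e \<noteq> 0}"
      have "sT c x + y = (\<Sum>e\<in>S'. tensor e (slice (\<phi> e) (sT c x + y)))"
        if S': "finite S'" "S \<union> ?R \<subseteq> S'" for S'
      proof -
        have "a = (\<Sum>e\<in>?R. s1 (\<phi> e a) e)"
          unfolding \<phi>_def using V1.sum_nonzero_representation_eq[of E a] E by simp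
        also have "\<dots> = (\<Sum>e\<in>S'. s1 (\<phi> e a) e)"
          by (rule sum.mono_neutral_left) (use S' in \<open>auto simp: \<phi>_def\<close>)
        finally have "x = tensor (\<Sum>e\<in>S'. s1 (\<phi> e a) e) b" unfolding x by simp
        also have "\<dots> = (\<Sum>e\<in>S'. tensor e (slice (\<phi> e) x))"
          by (simp add: x tensor_sum_left tensor_scale_left tensor_scale_right slice_tensor[OF \<phi>])
        finally have x': "(\<Sum>e\<in>S'. tensor e (slice (\<phi> e) x)) = x" ..
        have y': "(\<Sum>e\<in>S'. tensor e (slice (\<phi> e) y)) = y"
          by (rule S(2)[symmetric]) (use S' in simp_all)
        have "(\<Sum>e\<in>S'. tensor e (slice (\<phi> e) (sT c x + y))) =
            sT c (\<Sum>e\<in>S'. tensor e (slice (\<phi> e) x)) + (\<Sum>e\<in>S'. tensor e (slice (\<phi> e) y))"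
          by (simp add: slice.add slice.scale tensor_add_right tensor_scale_right sum.distrib
              VT.scale_sum_right)
        then show ?thesis unfolding x' y' ..
      qed
      moreover have "finite (S \<union> ?R)"
        using S(1) V1.finite_representation by simp
      ultimately show ?case by blast
    qed
  qed
  then obtain S where "t = (\<Sum>e\<in>S. tensor e (slice (\<phi> e) t))" by blast
  also have "\<dots> \<in> tensor_subspace sT tensor UNIV B"
    unfolding tensor_subspace_def using slices[OF \<phi>]
    by (intro VT.span_sum VT.span_base) blast
  finally show ?thesis .
qed

lemma tensor_subspace_subset:
  assumes "VT.subspace W" "\<And>a b. b \<in> B \<Longrightarrow> tensor a b \<in> W"
  shows "tensor_subspace sT tensor UNIV B \<subseteq> W"
  unfolding tensor_subspace_def
  by (rule VT.span_minimal) (use assms in auto)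

text \<open>The case \<open>B = {0}\<close> of \<open>in_tensor_subspace\<close>.\<close>

lemma eq_0_if_slices_eq_0:
  assumes "\<And>\<phi>. Vector_Spaces.linear s1 (*) \<phi> \<Longrightarrow> slice \<phi> t = 0"
  shows "t = 0"
proof -
  have "t \<in> tensor_subspace sT tensor UNIV {0}"
    by (rule in_tensor_subspace) (simp add: assms)
  also have "\<dots> \<subseteq> {0}"
    by (rule tensor_subspace_subset) (simp_all add: VT.subspace_single_0)
  finally show ?thesis by simp
qed

end

section \<open>Operators of the form g \<otimes> h\<close>

locale tensor_operator = tensor_product s1 s2 sT tensor +
  G: endomorphism s1 g + H: endomorphism s2 h + F: endomorphism sT f
  for s1 :: "'k::field \<Rightarrow> 'a::ab_group_add \<Rightarrow> 'a"
    and s2 :: "'k \<Rightarrow> 'b::ab_group_add \<Rightarrow> 'b"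
    and sT :: "'k \<Rightarrow> 't::ab_group_add \<Rightarrow> 't"
    and tensor g h f +
  assumes f_tensor: "f (tensor a b) = tensor (g a) (h b)"
begin

text \<open>Gives access to slices along the second factor, where \<open>g\<close> and
  \<open>h\<close> exchange their roles.\<close>

lemma swap_operator: "tensor_operator s2 s1 sT (\<lambda>b a. tensor a b) h g f"
  using swap f_tensor
  by (simp add: tensor_operator_def tensor_operator_axioms_def
      G.endomorphism_axioms H.endomorphism_axioms F.endomorphism_axioms)

lemma funpow_tensor: "(f ^^ n) (tensor a b) = tensor ((g ^^ n) a) ((h ^^ n) b)"
  by (induction n) (simp_all add: f_tensor)

text \<open>Both sides are linear in \<open>t\<close>, and on a pure tensor of \<open>a\<close> and
  \<open>b\<close> both equal \<open>(h ^^ n) b\<close> scaled by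
  \<open>\<phi> ((g ^^ n) a)\<close>.\<close>

lemma slice_funpow:
  assumes "Vector_Spaces.linear s1 (*) \<phi>"
  shows "slice \<phi> ((f ^^ n) t) = (h ^^ n) (slice (\<phi> \<circ> (g ^^ n)) t)"
proof -
  have 1: "Vector_Spaces.linear s1 (*) (\<phi> \<circ> (g ^^ n))"
    using G.linear_funpow assms by (rule Vector_Spaces.linear_compose)
  have "(slice \<phi> \<circ> (f ^^ n)) t = ((h ^^ n) \<circ> slice (\<phi> \<circ> (g ^^ n))) t"
  proof (rule linear_eqI)
    show "Vector_Spaces.linear sT s2 (slice \<phi> \<circ> (f ^^ n))"
      using F.linear_funpow linear_slice[OF assms] by (rule Vector_Spaces.linear_compose)
    show "Vector_Spaces.linear sT s2 ((h ^^ n) \<circ> slice (\<phi> \<circ> (g ^^ n)))"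
      using linear_slice[OF 1] H.linear_funpow by (rule Vector_Spaces.linear_compose)
    show "(slice \<phi> \<circ> (f ^^ n)) (tensor a b) = ((h ^^ n) \<circ> slice (\<phi> \<circ> (g ^^ n))) (tensor a b)" for a b
      by (simp add: funpow_tensor slice_tensor[OF assms] slice_tensor[OF 1] H.pow.scale)
  qed
  then show ?thesis by simp
qed

text \<open>Over a field the injective map \<open>g ^^ n\<close> has a linear left inverse
  \<open>k\<close>; take \<open>\<psi> = \<phi> \<circ> k\<close>.\<close>

lemma functional_factors:
  assumes "inj g" "Vector_Spaces.linear s1 (*) \<phi>"
  obtains \<psi> where "Vector_Spaces.linear s1 (*) \<psi>" "\<phi> = \<psi> \<circ> (g ^^ n)"
proof -
  interpret vector_space_pair s1 s1 by unfold_locales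
  have "inj (g ^^ n)" using assms(1) by (induction n) (auto simp: inj_compose)
  then obtain k where k: "Vector_Spaces.linear s1 s1 k" "k \<circ> (g ^^ n) = id"
    using linear_injective_left_inverse[OF G.linear_funpow] by blast
  show thesis
  proof (rule that)
    show "Vector_Spaces.linear s1 (*) (\<phi> \<circ> k)"
      using k(1) assms(2) by (rule Vector_Spaces.linear_compose)
    show "\<phi> = (\<phi> \<circ> k) \<circ> (g ^^ n)"
      using k(2) by (simp add: comp_assoc)
  qed
qed

text \<open>With \<open>\<phi> = \<psi> \<circ> (g ^^ n)\<close>, the vector in question is the
  \<open>\<psi>\<close>-slice of \<open>(f ^^ n) t\<close>.\<close>

lemma slice_funpow_eq_0:
  assumes "inj g" "Vector_Spaces.linear s1 (*) \<phi>" "(f ^^ n) t = 0"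
  shows "(h ^^ n) (slice \<phi> t) = 0"
proof -
  obtain \<psi> where \<psi>: "Vector_Spaces.linear s1 (*) \<psi>" "\<phi> = \<psi> \<circ> (g ^^ n)"
    using functional_factors[OF assms(1,2)] .
  interpret slice: Vector_Spaces.linear sT s2 "slice \<psi>"
    using \<psi>(1) by (rule linear_slice)
  show ?thesis
    using slice_funpow[OF \<psi>(1), of n t] assms(3) slice.zero unfolding \<psi>(2) by simp
qed

text \<open>Slices of a kernel element lie in the kernel of \<open>h\<close> by
  \<open>slice_funpow_eq_0\<close> for \<open>n = 1\<close>; the other inclusion is checked on pure
  tensors.\<close>

lemma kernel_eq:
  assumes "inj g"
  shows "{t. f t = 0} = tensor_subspace sT tensor UNIV {b. h b = 0}"
proof
  show "{t. f t = 0} \<subseteq> tensor_subspace sT tensor UNIV {b. h b = 0}"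
    using slice_funpow_eq_0[OF assms, of _ 1] by (auto intro!: in_tensor_subspace)
  show "tensor_subspace sT tensor UNIV {b. h b = 0} \<subseteq> {t. f t = 0}"
  proof (rule tensor_subspace_subset)
    show "VT.subspace {t. f t = 0}" using F.pow.subspace_kernel[of 1] by simp
  qed (simp add: f_tensor)
qed

lemma locally_nilpotent_eq:
  assumes "inj g"
  shows "{t. \<exists>m. (f ^^ m) t = 0} = tensor_subspace sT tensor UNIV {b. \<exists>m. (h ^^ m) b = 0}"
proof
  show "{t. \<exists>m. (f ^^ m) t = 0} \<subseteq> tensor_subspace sT tensor UNIV {b. \<exists>m. (h ^^ m) b = 0}"
    using slice_funpow_eq_0[OF assms] by (blast intro: in_tensor_subspace)
  show "tensor_subspace sT tensor UNIV {b. \<exists>m. (h ^^ m) b = 0} \<subseteq> {t. \<exists>m. (f ^^ m) t = 0}"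
  proof (rule tensor_subspace_subset[OF F.subspace_locally_nilpotent])
    fix a b assume "b \<in> {b. \<exists>m. (h ^^ m) b = 0}"
    then obtain m where "(h ^^ m) b = 0" by blast
    then have "(f ^^ m) (tensor a b) = 0" by (simp add: funpow_tensor)
    then show "tensor a b \<in> {t. \<exists>m. (f ^^ m) t = 0}" by blast
  qed
qed

text \<open>Slicing along the second factor sends the range of \<open>f ^^ m\<close> into the range
  of \<open>g ^^ m\<close>, so all these slices of \<open>t\<close> vanish.\<close>

lemma Inter_range_funpow:
  assumes g: "\<And>a. (\<And>m. a \<in> range (g ^^ m)) \<Longrightarrow> a = 0"
    and t: "\<And>m. t \<in> range (f ^^ m)"
  shows "t = 0"
proof -
  interpret S: tensor_operator s2 s1 sT "\<lambda>b a. tensor a b" h g f by (rule swap_operator)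
  show ?thesis
  proof (rule S.eq_0_if_slices_eq_0)
    fix \<psi> :: "'b \<Rightarrow> 'k" assume \<psi>: "Vector_Spaces.linear s2 (*) \<psi>"
    show "S.slice \<psi> t = 0"
    proof (rule g)
      fix m
      obtain x where "t = (f ^^ m) x" using t by blast
      then show "S.slice \<psi> t \<in> range (g ^^ m)" by (simp add: S.slice_funpow[OF \<psi>])
    qed
  qed
qed

lemma locally_finite_eq_nilpotent:
  assumes "inj g" "\<And>a. (\<And>m. a \<in> range (g ^^ m)) \<Longrightarrow> a = 0"
  shows "{t. F.locally_finite t} = tensor_subspace sT tensor UNIV {b. \<exists>m. (h ^^ m) b = 0}"
  unfolding locally_nilpotent_eq[OF assms(1), symmetric]
  using F.locally_finite_imp_locally_nilpotent Inter_range_funpow[OF assms(2)]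
    F.locally_nilpotent_imp_locally_finite
  by blast

text \<open>A solution of \<open>f t = sT l t\<close> with \<open>l \<noteq> 0\<close> lies in the
  ranges of all powers of \<open>f\<close> and is therefore zero. Only the kernel remains, which is
  its own span.\<close>

lemma eigenspaces_eq_kernel:
  assumes "inj g" "\<And>a. (\<And>m. a \<in> range (g ^^ m)) \<Longrightarrow> a = 0"
  shows "VT.span {t. \<exists>l. f t = sT l t} = tensor_subspace sT tensor UNIV {b. h b = 0}"
proof -
  have "f t = 0" if "f t = sT l t" for t l
  proof (cases "l = 0")
    case False
    have "t = 0"
      using Inter_range_funpow[OF assms(2)] F.eigenvector_in_range_funpow[OF that False] by blast
    then show ?thesis using that by simp
  qed (use that in simp)
  moreover have "\<exists>l. f t = sT l t" if "f t = 0" for t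
    using that by (intro exI[of _ 0]) simp
  ultimately have "{t. \<exists>l. f t = sT l t} = {t. f t = 0}" by blast
  moreover have "VT.span {t. f t = 0} = {t. f t = 0}"
    using F.pow.subspace_kernel[of 1] by (simp add: VT.span_eq_iff)
  ultimately show ?thesis
    using kernel_eq[OF assms(1)] by simp
qed

end

section \<open>The case of a nonzero scalar in the first factor\<close>

locale tensor_operator_scalar = tensor_operator s1 s2 sT tensor "s1 c" h f
  for s1 :: "'k::field \<Rightarrow> 'a::ab_group_add \<Rightarrow> 'a"
    and s2 :: "'k \<Rightarrow> 'b::ab_group_add \<Rightarrow> 'b"
    and sT :: "'k \<Rightarrow> 't::ab_group_add \<Rightarrow> 't"
    and tensor h f c +
  assumes c: "c \<noteq> 0"
begin

lemma funpow_scale: "(s1 c ^^ n) a = s1 (c ^ n) a"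
  by (induction n) simp_all

text \<open>Composing \<open>\<phi>\<close> with the \<open>n\<close>-th power of
  \<open>s1 c\<close> multiplies it by \<open>c ^ n\<close>, and a slice is homogeneous in its
  functional, as pure tensors show.\<close>

lemma slice_funpow_scalar:
  assumes "Vector_Spaces.linear s1 (*) \<phi>"
  shows "slice \<phi> ((f ^^ n) t) = s2 (c ^ n) ((h ^^ n) (slice \<phi> t))"
proof -
  have "\<phi> \<circ> (s1 c ^^ n) = (\<lambda>a. c ^ n * \<phi> a)"
    using assms by (auto simp: funpow_scale Vector_Spaces.linear_iff)
  moreover have "slice (\<lambda>a. c ^ n * \<phi> a) t = s2 (c ^ n) (slice \<phi> t)"
  proof -
    have 1: "Vector_Spaces.linear s1 (*) (\<lambda>a. c ^ n * \<phi> a)"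
      using assms by (auto simp: Vector_Spaces.linear_iff algebra_simps)
    interpret slice: Vector_Spaces.linear sT s2 "slice \<phi>"
      using assms by (rule linear_slice)
    show ?thesis
    proof (rule linear_eqI[OF linear_slice[OF 1]])
      show "Vector_Spaces.linear sT s2 (\<lambda>t. s2 (c ^ n) (slice \<phi> t))"
        using linear_slice[OF assms] V2.scale_left_commute V2.scale_right_distrib
        by (auto simp: Vector_Spaces.linear_iff)
    qed (simp add: slice_tensor[OF 1] slice_tensor[OF assms])
  qed
  ultimately show ?thesis
    using slice_funpow[OF assms, of n t] by (simp add: H.pow.scale)
qed

text \<open>Slicing, and tensoring with a fixed \<open>a\<close>, intertwine \<open>f\<close> and
  \<open>h\<close> up to powers of \<open>c\<close>. As \<open>c\<close> is invertible,
  \<open>locally_finite_transfer\<close> absorbs them in both directions.\<close>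

lemma locally_finite_eq:
  "{t. F.locally_finite t} = tensor_subspace sT tensor UNIV {b. H.locally_finite b}"
proof
  show "{t. F.locally_finite t} \<subseteq> tensor_subspace sT tensor UNIV {b. H.locally_finite b}"
  proof (clarify, rule in_tensor_subspace, simp)
    fix t and \<phi> :: "'a \<Rightarrow> 'k"
    assume t: "F.locally_finite t" and \<phi>: "Vector_Spaces.linear s1 (*) \<phi>"
    have "(h ^^ n) (slice \<phi> t) = s2 (1 / c ^ n) (slice \<phi> ((f ^^ n) t))" for n
      by (simp add: slice_funpow_scalar[OF \<phi>] c)
    then show "H.locally_finite (slice \<phi> t)"
      by (rule locally_finite_transfer[OF F.endomorphism_axioms H.endomorphism_axioms
            linear_slice[OF \<phi>] t])
  qed
  show "tensor_subspace sT tensor UNIV {b. H.locally_finite b} \<subseteq> {t. F.locally_finite t}"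
  proof (rule tensor_subspace_subset[OF F.subspace_locally_finite], simp)
    fix a b assume b: "H.locally_finite b"
    have "(f ^^ n) (tensor a b) = sT (c ^ n) (tensor a ((h ^^ n) b))" for n
      by (simp add: funpow_tensor funpow_scale tensor_scale_left)
    then show "F.locally_finite (tensor a b)"
      by (rule locally_finite_transfer[OF H.endomorphism_axioms F.endomorphism_axioms
            linear_tensor_right b])
  qed
qed

text \<open>Since \<open>f\<close> is \<open>c\<close> times \<open>id \<otimes> h\<close>, slices
  carry the eigenvalue \<open>l\<close> of \<open>f\<close> to \<open>l / c\<close> for
  \<open>h\<close>, and tensoring carries \<open>l\<close> for \<open>h\<close> to
  \<open>c * l\<close> for \<open>f\<close>.\<close>

lemma eigenspaces_eq:
  "VT.span {t. \<exists>l. f t = sT l t} =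
     tensor_subspace sT tensor UNIV (V2.span {b. \<exists>l. h b = s2 l b})"
proof
  show "VT.span {t. \<exists>l. f t = sT l t}
    \<subseteq> tensor_subspace sT tensor UNIV (V2.span {b. \<exists>l. h b = s2 l b})"
  proof (rule VT.span_minimal)
    show "VT.subspace (tensor_subspace sT tensor UNIV (V2.span {b. \<exists>l. h b = s2 l b}))"
      unfolding tensor_subspace_def by (rule VT.subspace_span)
    show "{t. \<exists>l. f t = sT l t} \<subseteq> tensor_subspace sT tensor UNIV (V2.span {b. \<exists>l. h b = s2 l b})"
    proof (clarify, rule in_tensor_subspace, rule V2.span_base, clarify)
      fix t l and \<phi> :: "'a \<Rightarrow> 'k"
      assume t: "f t = sT l t" and \<phi>: "Vector_Spaces.linear s1 (*) \<phi>"
      interpret slice: Vector_Spaces.linear sT s2 "slice \<phi>"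
        using \<phi> by (rule linear_slice)
      have "s2 c (h (slice \<phi> t)) = s2 l (slice \<phi> t)"
        using slice_funpow_scalar[OF \<phi>, of 1 t] by (simp add: t slice.scale)
      then have "s2 (1 / c) (s2 c (h (slice \<phi> t))) = s2 (1 / c) (s2 l (slice \<phi> t))" by simp
      then have "h (slice \<phi> t) = s2 (l / c) (slice \<phi> t)" using c by simp
      then show "\<exists>l. h (slice \<phi> t) = s2 l (slice \<phi> t)" ..
    qed
  qed
  show "tensor_subspace sT tensor UNIV (V2.span {b. \<exists>l. h b = s2 l b})
    \<subseteq> VT.span {t. \<exists>l. f t = sT l t}"
  proof (rule tensor_subspace_subset[OF VT.subspace_span])
    fix a b assume b: "b \<in> V2.span {b. \<exists>l. h b = s2 l b}"
    interpret R: Vector_Spaces.linear s2 sT "tensor a" by (rule linear_tensor_right)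
    have "tensor a b \<in> VT.span (tensor a ` {b. \<exists>l. h b = s2 l b})"
      using b by (simp add: R.span_image)
    also have "\<dots> \<subseteq> VT.span {t. \<exists>l. f t = sT l t}"
    proof (rule VT.span_mono, clarify)
      fix b l assume "h b = s2 l b"
      then have "f (tensor a b) = sT (c * l) (tensor a b)"
        by (simp add: f_tensor tensor_scale_left tensor_scale_right)
      then show "\<exists>l. f (tensor a b) = sT l (tensor a b)" ..
    qed
    finally show "tensor a b \<in> VT.span {t. \<exists>l. f t = sT l t}" .
  qed
qed

end

section \<open>Poisson algebras with a degree map\<close>

context nc_poisson_algebra
begin

lemma endomorphism_bracket: "endomorphism scale (bracket z)"
  by unfold_locales (simp_all add: bracket_add_right bracket_scale_right)

lemma endomorphism_mult: "endomorphism scale ((*) z)"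
  by unfold_locales (simp_all add: distrib_left scale_mult_right)

lemma ad_F_eq: "ad_F scale bracket z = {x. endomorphism.locally_finite scale (bracket z) x}"
proof -
  interpret endomorphism scale "bracket z" by (rule endomorphism_bracket)
  show ?thesis
    unfolding ad_F_def ad_orbit_def op_poly_def[symmetric] finite_dim_orbit_iff ..
qed

lemma ad_D_eq: "ad_D scale bracket z = span {x. \<exists>l. bracket z x = scale l x}"
proof -
  let ?U = "\<Union>l \<in> Ev scale bracket z. eigenspace scale bracket z l"
  have "?U \<subseteq> {x. \<exists>l. bracket z x = scale l x}"
    by (auto simp: eigenspace_def)
  \<comment> \<open>The zero vector solves the equation for every \<open>l\<close>, also outside
    \<open>Ev\<close>; adjoining it explicitly does not change the span.\<close>
  moreover have "{x. \<exists>l. bracket z x = scale l x} \<subseteq> insert 0 ?U"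
    by (auto simp: eigenspace_def Ev_def)
  ultimately have "span {x. \<exists>l. bracket z x = scale l x} = span ?U"
    by (metis span_insert_0 span_mono subset_antisym)
  then show ?thesis unfolding ad_D_def by simp
qed

end

locale degree_poisson_algebra = nc_poisson_algebra scale bracket
  for scale :: "'k::alg_closed_field \<Rightarrow> 'p::ring_1 \<Rightarrow> 'p" and bracket +
  fixes u :: "'p \<Rightarrow> int extended"
  assumes degree_map: "degree_map bracket u"
    and nonneg: "range u \<subseteq> insert Minf (Fin ` {0..})"
    and finite_filtration: "finite_filtration scale u"
begin

lemma degree_mult: "u (z * w) = u z + u w"
  using degree_map by (simp add: degree_map_def)

lemma degree_eq_Minf_iff: "u z = Minf \<longleftrightarrow> z = 0"
  using degree_map by (simp add: degree_map_def)

lemma degree_nonzero: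
  assumes "z \<noteq> 0"
  obtains n where "n \<ge> 0" "u z = Fin n"
  using nonneg assms degree_eq_Minf_iff by (metis atLeast_iff imageE insertE range_subsetD)

text \<open>Nonzero elements have finite degree and degrees add, so a product of two of them has
  finite degree.\<close>

lemma mult_eq_0_iff: "z * w = 0 \<longleftrightarrow> z = 0 \<or> w = 0" for z w :: 'p
proof
  assume zw: "z * w = 0"
  show "z = 0 \<or> w = 0"
  proof (rule ccontr)
    assume "\<not> (z = 0 \<or> w = 0)"
    then obtain m n where "u z = Fin m" "u w = Fin n" using degree_nonzero by metis
    then have "u (z * w) \<noteq> Minf" by (simp add: degree_mult)
    then show False using zw degree_eq_Minf_iff by blast
  qed
qed auto

lemma inj_mult: "inj ((*) z)" if "z \<noteq> 0" for z :: 'p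
proof (rule injI)
  fix a b assume "z * a = z * b"
  then have "z * (a - b) = 0" by (simp add: right_diff_distrib)
  then show "a = b" using that by (simp add: mult_eq_0_iff)
qed

lemma degree_1: "u 1 = Fin 0"
proof -
  obtain n where "u 1 = Fin n" using degree_nonzero[of 1] by auto
  then show ?thesis using degree_mult[of 1 1] by simp
qed

lemma degree_funpow_mult:
  assumes "u z = Fin m" "u a = Fin n"
  shows "u (((*) z ^^ i) a) = Fin (int i * m + n)"
  by (induction i) (simp_all add: assms degree_mult algebra_simps)

lemma degree_pos:
  assumes "z \<notin> scalars scale"
  obtains n where "n > 0" "u z = Fin n"
proof -
  have "z \<noteq> 0" using assms unfolding scalars_def by (metis rangeI scale_zero_left)
  then obtain n where n: "n \<ge> 0" "u z = Fin n" by (rule degree_nonzero)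
  have "n \<noteq> 0"
  proof
    assume "n = 0"
    interpret endomorphism scale "(*) z" by (rule endomorphism_mult)
    obtain B where "finite B" "filtration u 0 = span B"
      using finite_filtration unfolding finite_filtration_def finite_dim_subspace_def by blast
    moreover have "((*) z ^^ i) 1 \<in> filtration u 0" for i
      using degree_funpow_mult[OF n(2) degree_1] \<open>n = 0\<close> by (simp add: filtration_def)
    ultimately have "locally_finite 1" unfolding locally_finite_def by blast
    then obtain l y where y: "y \<noteq> 0" "z * y = scale l y"
      using locally_finite_imp_eigenvector[OF endomorphism_mult _ one_neq_zero] by blast
    \<comment> \<open>As there are no zero divisors, the eigenvector \<open>y\<close> can be
      cancelled, which identifies \<open>z\<close> with its eigenvalue.\<close>
    then have "(z - scale l 1) * y = 0"
      by (simp add: left_diff_distrib scale_mult_left)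
    then have "z = scale l 1" using y(1) by (simp add: mult_eq_0_iff)
    then show False using assms unfolding scalars_def by blast
  qed
  then show thesis using n that by simp
qed

text \<open>A nonzero element in the range of the \<open>m\<close>-th power has degree at least
  \<open>m\<close>, since \<open>z\<close> has degree at least 1 and no nonzero element has negative
  degree.\<close>

lemma Inter_range_funpow_mult:
  assumes "z \<notin> scalars scale" "\<And>m. a \<in> range ((*) z ^^ m)"
  shows "a = 0"
proof (rule ccontr)
  assume "a \<noteq> 0"
  then obtain d where d: "d \<ge> 0" "u a = Fin d" by (rule degree_nonzero)
  obtain n where n: "n > 0" "u z = Fin n" using degree_pos[OF assms(1)] .
  \<comment> \<open>The least exponent above the degree of \<open>a\<close>.\<close>
  define m where "m = Suc (nat d)"
  obtain w where w: "a = ((*) z ^^ m) w" using assms(2) by blast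
  interpret endomorphism scale "(*) z" by (rule endomorphism_mult)
  have "w \<noteq> 0" using w \<open>a \<noteq> 0\<close> pow.zero by metis
  then obtain e where e: "e \<ge> 0" "u w = Fin e" by (rule degree_nonzero)
  have "d = int m * n + e"
    using d(2) degree_funpow_mult[OF n(2) e(2), of m] unfolding w by simp
  moreover have "int m * 1 \<le> int m * n" using n(1) by (intro mult_left_mono) auto
  moreover have "d < int m" using d(1) by (simp add: m_def)
  ultimately show False using e(1) by linarith
qed

end

text \<open>Both classes give the same formula, that of \<open>L \<otimes> A\<close>. In Class 1 the
  term with \<open>br1 z1 a\<close> vanishes; in Class 2 the commutator collapses because
  \<open>z1\<close> commutes with \<open>a\<close>.\<close>

lemma bracket_pure_tensor:
  assumes "(poisson_class1 br1 \<and> poisson_class1 br2) \<or> (poisson_class2 br1 \<and> poisson_class2 br2)"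
    and T: "poisson_tensor_product s1 br1 s2 br2 sT brT tensor"
    and V: "vector_space s1" "vector_space s2"
    and z1: "z1 \<in> poisson_center br1"
  shows "brT (tensor z1 z2) (tensor a b) = tensor (z1 * a) (br2 z2 b)"
proof -
  interpret T: nc_poisson_algebra sT brT
    using T unfolding poisson_tensor_product_def by blast
  interpret tensor_product s1 s2 sT tensor
    using T V unfolding poisson_tensor_product_def tensor_product_def tensor_product_axioms_def
    by (simp add: T.vector_space_axioms)
  have z: "z1 * a = a * z1" "br1 z1 a = 0"
    using z1 by (simp_all add: poisson_center_def)
  from assms(1) show ?thesis
  proof
    assume "poisson_class1 br1 \<and> poisson_class1 br2"
    then show ?thesis using T z by (simp add: poisson_tensor_product_def)
  next
    assume c: "poisson_class2 br1 \<and> poisson_class2 br2"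
    interpret R: Vector_Spaces.linear s2 sT "tensor (z1 * a)" by (rule linear_tensor_right)
    have "brT (tensor z1 z2) (tensor a b) = tensor (z1 * a) (z2 * b) - tensor (a * z1) (b * z2)"
      using T c by (simp add: poisson_tensor_product_def)
    also have "\<dots> = tensor (z1 * a) (z2 * b - b * z2)"
      by (simp add: z(1)[symmetric] R.diff)
    also have "\<dots> = tensor (z1 * a) (br2 z2 b)"
      using c by (simp add: poisson_class2_def)
    finally show ?thesis .
  qed
qed

theorem theorem5p5:
  fixes s1 :: "'k::{alg_closed_field, field_char_0} \<Rightarrow> 'a::ring_1 \<Rightarrow> 'a"
    and s2 :: "'k \<Rightarrow> 'b::ring_1 \<Rightarrow> 'b"
    and sT :: "'k \<Rightarrow> 't::ring_1 \<Rightarrow> 't"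
    and br1 :: "'a \<Rightarrow> 'a \<Rightarrow> 'a" and br2 :: "'b \<Rightarrow> 'b \<Rightarrow> 'b" and brT :: "'t \<Rightarrow> 't \<Rightarrow> 't"
    and tensor :: "'a \<Rightarrow> 'b \<Rightarrow> 't"
    and u1 :: "'a \<Rightarrow> int extended" and u2 :: "'b \<Rightarrow> int extended"
    and z1 :: 'a and z2 :: 'b and \<Theta> :: 't
  assumes "nc_poisson_algebra s1 br1" and "nc_poisson_algebra s2 br2"
    and "(poisson_class1 br1 \<and> poisson_class1 br2) \<or> (poisson_class2 br1 \<and> poisson_class2 br2)"
    and "poisson_tensor_product s1 br1 s2 br2 sT brT tensor"
    and "degree_map br1 u1" and "range u1 \<subseteq> insert Minf (Fin ` {0..})"
    and "finite_filtration s1 u1" and "discrete_filtration u1"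
    and "degree_map br2 u2" and "range u2 \<subseteq> insert Minf (Fin ` {0..})"
    and "finite_filtration s2 u2" and "discrete_filtration u2"
    and "\<Theta> = tensor z1 z2"
  shows
    "(z1 \<in> poisson_center br1 \<and> z2 \<in> poisson_center br2 \<longrightarrow> \<Theta> \<in> poisson_center brT) \<and>
     (z1 \<in> poisson_center br1 \<and> z2 \<notin> poisson_center br2 \<longrightarrow>
        (z1 \<notin> scalars s1 \<longrightarrow>
           ad_F sT brT \<Theta> = tensor_subspace sT tensor UNIV (ad_N br2 z2)) \<and>
        (z1 \<in> nonzero_scalars s1 \<longrightarrow>
           ad_F sT brT \<Theta> = tensor_subspace sT tensor UNIV (ad_F s2 br2 z2)) \<and>
        (z1 \<notin> scalars s1 \<longrightarrow>
           ad_D sT brT \<Theta> = tensor_subspace sT tensor UNIV (ad_C br2 z2)) \<and>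
        (z1 \<in> nonzero_scalars s1 \<longrightarrow>
           ad_D sT brT \<Theta> = tensor_subspace sT tensor UNIV (ad_D s2 br2 z2)) \<and>
        (z1 \<noteq> 0 \<longrightarrow>
           ad_N brT \<Theta> = tensor_subspace sT tensor UNIV (ad_N br2 z2) \<and>
           ad_C brT \<Theta> = tensor_subspace sT tensor UNIV (ad_C br2 z2)))"
proof -
  interpret P1: degree_poisson_algebra s1 br1 u1
    using assms(1,5-7) by (simp add: degree_poisson_algebra_def degree_poisson_algebra_axioms_def)
  interpret P2: nc_poisson_algebra s2 br2 by fact
  interpret PT: nc_poisson_algebra sT brT
    using assms(4) unfolding poisson_tensor_product_def by blast
  interpret G: endomorphism s1 "(*) z1" by (rule P1.endomorphism_mult)
  interpret H: endomorphism s2 "br2 z2" by (rule P2.endomorphism_bracket)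
  interpret F: endomorphism sT "brT \<Theta>" by (rule PT.endomorphism_bracket)
  interpret TP: tensor_product s1 s2 sT tensor
    using assms(4) by unfold_locales (simp add: poisson_tensor_product_def)
  show ?thesis
  proof (intro conjI[OF impI impI]; elim conjE)
    assume z: "z1 \<in> poisson_center br1" "z2 \<in> poisson_center br2"
    have mult: "tensor a b * tensor a' b' = tensor (a * a') (b * b')" for a b a' b'
      using assms(4) by (simp add: poisson_tensor_product_def)
    \<comment> \<open>With right multiplication by \<open>\<Theta>\<close> as a linear map,
      centrality for the product is an equality of two linear maps, checked on pure tensors.\<close>
    interpret R: endomorphism sT "\<lambda>w. w * \<Theta>"
      by unfold_locales (simp_all add: distrib_right PT.scale_mult_left)
    have "\<Theta> * w = w * \<Theta>" for w
    proof (rule TP.linear_eqI[OF _ R.linear])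
      show "Vector_Spaces.linear sT sT ((*) \<Theta>)"
        by (rule endomorphism.linear) (rule PT.endomorphism_mult)
      show "\<Theta> * tensor a b = tensor a b * \<Theta>" for a b
        using z by (simp add: assms(13) mult poisson_center_def)
    qed
    \<comment> \<open>The bracket with \<open>\<Theta>\<close> is compared with the zero map on pure
      tensors, where its second factor is \<open>br2 z2 b = 0\<close>.\<close>
    moreover have "Vector_Spaces.linear sT sT (\<lambda>_. 0)"
      by (simp add: Vector_Spaces.linear_iff PT.vector_space_axioms)
    then have "brT \<Theta> w = 0" for w
    proof (rule TP.linear_eqI[OF F.linear])
      show "brT \<Theta> (tensor a b) = 0" for a b
        using z bracket_pure_tensor[OF assms(3,4) P1.vector_space_axioms P2.vector_space_axioms z(1)]
        by (simp add: assms(13) poisson_center_def)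
    qed
    ultimately show "\<Theta> \<in> poisson_center brT" by (simp add: poisson_center_def)
  next
    assume z1: "z1 \<in> poisson_center br1"
    interpret TO: tensor_operator s1 s2 sT tensor "(*) z1" "br2 z2" "brT \<Theta>"
      by unfold_locales (simp add: assms(13)
        bracket_pure_tensor[OF assms(3,4) P1.vector_space_axioms P2.vector_space_axioms z1])
    have nonzero: "z1 \<noteq> 0" if "z1 \<notin> scalars s1"
      using that unfolding scalars_def by (metis rangeI P1.scale_zero_left)
    \<comment> \<open>Multiplication by a scalar multiple of 1 is scaling, which brings the operator
      into the scalar case.\<close>
    have scalar: "\<exists>c. tensor_operator_scalar s1 s2 sT tensor (br2 z2) (brT \<Theta>) c"
      if z: "z1 \<in> nonzero_scalars s1"
    proof -
      obtain c where c: "c \<noteq> 0" "z1 = s1 c 1"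
        using z unfolding nonzero_scalars_def by blast
      have L: "(*) z1 = s1 c"
        unfolding c(2) by (rule ext) (simp only: P1.scale_mult_left mult_1)
      have "tensor_operator_scalar s1 s2 sT tensor (br2 z2) (brT \<Theta>) c"
        using TO.tensor_operator_axioms c(1)
        unfolding L tensor_operator_scalar_def tensor_operator_scalar_axioms_def by blast
      then show ?thesis ..
    qed
    \<comment> \<open>Outside K, multiplication by \<open>z1\<close> is injective and the ranges of
      its powers meet only in 0. Under these two conditions F reduces to N, and D to C.\<close>
    have transcendental:
      "ad_F sT brT \<Theta> = tensor_subspace sT tensor UNIV (ad_N br2 z2)"
      "ad_D sT brT \<Theta> = tensor_subspace sT tensor UNIV (ad_C br2 z2)"
      if z: "z1 \<notin> scalars s1"
      unfolding PT.ad_F_eq PT.ad_D_eq ad_N_def ad_C_def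
      using TO.locally_finite_eq_nilpotent TO.eigenspaces_eq_kernel
        P1.inj_mult[OF nonzero[OF z]] P1.Inter_range_funpow_mult[OF z] by blast+
    have nonzero_scalar:
      "ad_F sT brT \<Theta> = tensor_subspace sT tensor UNIV (ad_F s2 br2 z2)"
      "ad_D sT brT \<Theta> = tensor_subspace sT tensor UNIV (ad_D s2 br2 z2)"
      if z: "z1 \<in> nonzero_scalars s1"
    proof -
      obtain c where "tensor_operator_scalar s1 s2 sT tensor (br2 z2) (brT \<Theta>) c"
        using scalar[OF z] ..
      then interpret TS: tensor_operator_scalar s1 s2 sT tensor "br2 z2" "brT \<Theta>" c .
      show "ad_F sT brT \<Theta> = tensor_subspace sT tensor UNIV (ad_F s2 br2 z2)"
        unfolding PT.ad_F_eq P2.ad_F_eq by (rule TS.locally_finite_eq)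
      show "ad_D sT brT \<Theta> = tensor_subspace sT tensor UNIV (ad_D s2 br2 z2)"
        unfolding PT.ad_D_eq P2.ad_D_eq by (rule TS.eigenspaces_eq)
    qed
    \<comment> \<open>Elements outside K and nonzero scalars are both covered by
      \<open>z1 \<noteq> 0\<close>. For \<open>z1 = 0\<close> the operator is zero, so C(\<Theta>)
      is the whole tensor product, whereas C(\<open>z2\<close>) is proper for noncentral
      \<open>z2\<close>.\<close>
    have injective:
      "ad_N brT \<Theta> = tensor_subspace sT tensor UNIV (ad_N br2 z2)"
      "ad_C brT \<Theta> = tensor_subspace sT tensor UNIV (ad_C br2 z2)" if "z1 \<noteq> 0"
      unfolding ad_N_def ad_C_def
      using TO.locally_nilpotent_eq TO.kernel_eq P1.inj_mult[OF that] by blast+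
    show "(z1 \<notin> scalars s1 \<longrightarrow>
           ad_F sT brT \<Theta> = tensor_subspace sT tensor UNIV (ad_N br2 z2)) \<and>
        (z1 \<in> nonzero_scalars s1 \<longrightarrow>
           ad_F sT brT \<Theta> = tensor_subspace sT tensor UNIV (ad_F s2 br2 z2)) \<and>
        (z1 \<notin> scalars s1 \<longrightarrow>
           ad_D sT brT \<Theta> = tensor_subspace sT tensor UNIV (ad_C br2 z2)) \<and>
        (z1 \<in> nonzero_scalars s1 \<longrightarrow>
           ad_D sT brT \<Theta> = tensor_subspace sT tensor UNIV (ad_D s2 br2 z2)) \<and>
        (z1 \<noteq> 0 \<longrightarrow>
           ad_N brT \<Theta> = tensor_subspace sT tensor UNIV (ad_N br2 z2) \<and>
           ad_C brT \<Theta> = tensor_subspace sT tensor UNIV (ad_C br2 z2))"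
      by (intro conjI impI transcendental nonzero_scalar injective)
  qed
qed

end
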